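(* Let $F\subset\mathbb{Z}^d$ be a finite set, let $\mathcal{L}\subset\mathbb{Z}^d$ be a full-rank sublattice, let $\varepsilon\in(0,1]$, and let $A=\bigcup_{n\in F}\big(n+[-\tfrac{\varepsilon}{2},\tfrac{\varepsilon}{2}]^d\big)$ be the $\varepsilon$-thickening of $F$. Then (a) \[ \sum_{n\in (F-F)\cap \mathcal{L}} |F\cap (F+n)| =\frac{1}{\det \mathcal{L}} |F|^2\varepsilon^{d} + \frac{1}{\varepsilon^d \det \mathcal{L}} \sum_{\xi \in \mathcal{L}^*\setminus \{0\}} \left | \hat{1}_{A}(\xi)\right |^2; \] (b) equivalently, \[ \sum_{n\in (F-F)\cap \mathcal{L}} |F\cap (F+n)| =\frac{1}{\det \mathcal{L}} |F|^2\varepsilon^{d} + \frac{\varepsilon^d}{ \det \mathcal{L}} \sum_{\xi \in \mathcal{L}^*\setminus \{0\}} \left( \prod_{k=1}^d \operatorname{sinc}^2(\varepsilon \xi_k) \left| \sum_{n \in F} e^{2\pi i\langle \xi, n\rangle} \right|^2 \right), \] where $\operatorname{sinc}(t)=\frac{\sin(\pi t)}{\pi t}$ for $t\neq 0$ and $\operatorname{sinc}(0)=1$.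
   Context: $F-F=\{a-b:a,b\in F\}$, $F+n=\{a+n:a\in F\}$, $|\cdot|$ is cardinality. The Fourier transform is $\hat h(\xi)=\int_{\mathbb{R}^d} h(x)e^{-2\pi i\langle x,\xi\rangle}\,dx$ and $1_A$ is the indicator function of $A$. $\det\mathcal{L}$ is the covolume (index in $\mathbb{Z}^d$) of $\mathcal{L}$ and $\mathcal{L}^*=\{\xi\in\mathbb{R}^d:\langle\xi,n\rangle\in\mathbb{Z}\ \forall n\in\mathcal{L}\}$ is the dual lattice. *)

theory Defs
  imports "HOL-Analysis.Analysis"
begin

definition int_points :: "(real ^ 'd) set" where
  "int_points = {x. \<forall>i. x $ i \<in> \<int>}"

text \<open>A subgroup of the integer points is automatically discrete, so only
  the rank condition has to be added to the subgroup axioms.\<close>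

definition full_rank_sublattice :: "(real ^ 'd) set \<Rightarrow> bool" where
  "full_rank_sublattice L \<longleftrightarrow>
     L \<subseteq> int_points \<and> 0 \<in> L \<and> (\<forall>x\<in>L. \<forall>y\<in>L. x - y \<in> L) \<and> span L = UNIV"

text \<open>The covolume of a full-rank sublattice of the integer points is its index,
  that is, the number of its cosets. There are finitely many of them, so the
  value 0 of \<^const>\<open>card\<close> on infinite sets does not occur.\<close>

definition lattice_det :: "(real ^ 'd) set \<Rightarrow> nat" where
  "lattice_det L = card ((\<lambda>x. (+) x ` L) ` int_points)"

definition dual_lattice :: "(real ^ 'd) set \<Rightarrow> (real ^ 'd) set" where
  "dual_lattice L = {\<xi>. \<forall>n\<in>L. \<xi> \<bullet> n \<in> \<int>}"

definition difference_set :: "(real ^ 'd) set \<Rightarrow> (real ^ 'd) set" where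
  "difference_set F = {a - b | a b. a \<in> F \<and> b \<in> F}"

definition translate :: "(real ^ 'd) set \<Rightarrow> real ^ 'd \<Rightarrow> (real ^ 'd) set" where
  "translate F n = (\<lambda>a. a + n) ` F"

definition thickening :: "real \<Rightarrow> (real ^ 'd) set \<Rightarrow> (real ^ 'd) set" where
  "thickening \<epsilon> F = (\<Union>n\<in>F. (+) n ` cbox (vec (- \<epsilon> / 2)) (vec (\<epsilon> / 2)))"

definition fourier :: "(real ^ 'd \<Rightarrow> complex) \<Rightarrow> real ^ 'd \<Rightarrow> complex" where
  "fourier h \<xi> =
     (LINT x|lebesgue. h x * exp (- 2 * complex_of_real pi * \<i> * complex_of_real (x \<bullet> \<xi>)))"

text \<open>The normalised sinc function; the constant \<open>sinc\<close> of HOL-Probability is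
  the unnormalised one, \<open>sin t / t\<close>.\<close>

definition norm_sinc :: "real \<Rightarrow> real" where
  "norm_sinc t = (if t = 0 then 1 else sin (pi * t) / (pi * t))"

end

theory Submission
  imports Defs
begin

text \<open>Write the dual lattice as a finite union of cosets \<open>\<eta> + \<int>\<^sup>d\<close>. On each coset the exponential sum
  is constant, and the product of the squared sinc factors sums to \<open>\<epsilon>\<^sup>-\<^sup>d\<close>, by the
  one-dimensional identity \<open>\<Sum>m\<in>\<int>. sinc\<^sup>2 (\<epsilon> (x + m)) = 1 / \<epsilon>\<close> for \<open>0 < \<epsilon> \<le> 1\<close>. What remains is
  character orthogonality on the finite group of cosets, which is dual to \<open>\<int>\<^sup>d / L\<close> and so has
  \<open>det L\<close> elements: it counts the pairs of points of \<open>F\<close> whose difference lies in \<open>L\<close>.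

  For \<open>\<epsilon> = 1\<close> the one-dimensional identity is the partial fraction expansion of
  \<open>\<pi>\<^sup>2 / sin\<^sup>2 (\<pi> x)\<close>, that is, the reflection formula of the trigamma function. For \<open>\<epsilon> = a / N\<close>,
  grouping the terms by residues modulo \<open>N\<close> reduces it to \<open>\<epsilon> = 1\<close> and the sum of a Fejer kernel over
  equally spaced points, which is where \<open>a \<le> N\<close> enters. Both sides are continuous in \<open>\<epsilon>\<close>.\<close>

section \<open>The one-dimensional sinc identity\<close>

lemma has_sum_Sigma_nonneg:
  fixes f :: "'a \<times> 'b \<Rightarrow> real"
  assumes f: "\<And>x. x \<in> A \<Longrightarrow> ((\<lambda>y. f (x, y)) has_sum g x) (B x)"
    and g: "(g has_sum S) A"
    and nonneg: "\<And>x y. x \<in> A \<Longrightarrow> y \<in> B x \<Longrightarrow> 0 \<le> f (x, y)"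
  shows "(f has_sum S) (Sigma A B)"
proof (rule has_sum_SigmaI)
  show "f summable_on Sigma A B"
    using f has_sum_imp_summable[OF g] nonneg by (rule summable_on_SigmaI)
qed (use f g in auto)

text \<open>Induction on the finite index set: a function on \<open>insert a A\<close> is a value at
  \<open>a\<close> together with a function on \<open>A\<close>, so the sum becomes a double sum of
  products. Nonnegativity allows it to be evaluated as an iterated sum. It carries the
  one-dimensional identity to all dimensions.\<close>

lemma has_sum_prod_PiE_nonneg:
  fixes f :: "'a \<Rightarrow> 'b \<Rightarrow> real"
  assumes "finite A"
    and "\<And>x. x \<in> A \<Longrightarrow> (f x has_sum S x) (B x)"
    and "\<And>x y. x \<in> A \<Longrightarrow> y \<in> B x \<Longrightarrow> 0 \<le> f x y"
  shows "((\<lambda>g. \<Prod>x\<in>A. f x (g x)) has_sum (\<Prod>x\<in>A. S x)) (PiE A B)"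
  using assms
proof (induction)
  case empty
  then show ?case by (auto intro: has_sum_finiteI)
next
  case (insert a A)
  let ?P = "\<lambda>g. \<Prod>x\<in>A. f x (g x)"
  have P: "(?P has_sum prod S A) (PiE A B)"
    using insert by simp
  have pos: "0 \<le> ?P g" if "g \<in> PiE A B" for g
    using that insert.prems by (auto intro!: prod_nonneg)
  have "((\<lambda>(y, g). f a y * ?P g) has_sum S a * prod S A) (B a \<times> PiE A B)"
  proof (rule has_sum_Sigma_nonneg)
    show "((\<lambda>y. f a y * prod S A) has_sum S a * prod S A) (B a)"
      using insert.prems by (intro has_sum_cmult_left) auto
    show "((\<lambda>g. case (y, g) of (y, g) \<Rightarrow> f a y * ?P g) has_sum f a y * prod S A) (PiE A B)" for y
      using has_sum_cmult_right[OF P] by simp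
  qed (use insert.prems pos in auto)
  moreover have "bij_betw (\<lambda>(y, g). g(a := y)) (B a \<times> PiE A B) (PiE (insert a A) B)"
    unfolding bij_betw_def PiE_insert_eq
    using insert.hyps by (auto intro!: inj_combinator)
  moreover have "?P (g(a := y)) = ?P g" for g y
    using insert.hyps by (intro prod.cong) auto
  ultimately show ?case
    using insert.hyps
    by (subst has_sum_reindex_bij_betw[symmetric]) (auto simp: case_prod_unfold)
qed

text \<open>The logarithmic derivative of the reflection formula for \<open>rGamma\<close> expresses
  \<open>Digamma (1 - z) - Digamma z\<close> as a cotangent; one more differentiation gives trigamma
  values on one side and the inverse squared sine on the other. The work is done in the complex
  plane and then specialised to real \<open>x\<close>.\<close>

lemma trigamma_reflection:
  fixes x :: real
  assumes x: "0 < x" "x < 1"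
  shows "Polygamma 1 x + Polygamma 1 (1 - x) = pi\<^sup>2 / (sin (pi * x))\<^sup>2"
proof -
  \<comment> \<open>On this open strip neither \<open>z\<close> nor \<open>1 - z\<close> is a pole,
    and the symmetry under \<open>z\<close> to \<open>1 - z\<close> is kept.\<close>
  define S where "S = {z. 0 < Re z} \<inter> {z. Re z < 1}"
  have open_S: "open S"
    unfolding S_def by (intro open_Int open_halfspace_Re_gt open_halfspace_Re_lt)
  have nonpos: "z \<notin> \<int>\<^sub>\<le>\<^sub>0" "1 - z \<notin> \<int>\<^sub>\<le>\<^sub>0" if "z \<in> S" for z
    using that by (auto simp: S_def elim!: nonpos_Ints_cases' dest!: arg_cong[of _ _ Re])
  have rg: "rGamma z * rGamma (1 - z) = sin (of_real pi * z) / of_real pi" for z :: complex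
    by (rule rGamma_reflection_complex)
  have rg_nz: "sin (of_real pi * z) \<noteq> 0" if "z \<in> S" for z
    using rg[of z] nonpos[OF that] by (auto simp: rGamma_eq_zero_iff)
  have dig: "Digamma (1 - z) - Digamma z = of_real pi * cos (of_real pi * z) / sin (of_real pi * z)"
    if z: "z \<in> S" for z
  proof -
    have "((\<lambda>z. rGamma z * rGamma (1 - z)) has_field_derivative
            rGamma z * rGamma (1 - z) * (Digamma (1 - z) - Digamma z)) (at z)"
      using nonpos[OF z] by (auto intro!: derivative_eq_intros simp: algebra_simps)
    moreover have "((\<lambda>z. rGamma z * rGamma (1 - z)) has_field_derivative cos (of_real pi * z)) (at z)"
      unfolding rg by (auto intro!: derivative_eq_intros)
    ultimately have "rGamma z * rGamma (1 - z) * (Digamma (1 - z) - Digamma z) = cos (of_real pi * z)"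
      by (rule DERIV_unique)
    then show ?thesis
      using rg_nz[OF z] unfolding rg by (simp add: field_simps)
  qed
  define z where "z = complex_of_real x"
  have z: "z \<in> S" using x by (simp add: S_def z_def)
  have "((\<lambda>z. Digamma (1 - z) - Digamma z) has_field_derivative
          - Polygamma 1 (1 - z) - Polygamma 1 z) (at z)"
    using nonpos[OF z] by (auto intro!: derivative_eq_intros)
  \<comment> \<open>Since \<open>dig\<close> holds on the whole open strip, its two sides have the
    same derivative at \<open>z\<close>.\<close>
  then have "((\<lambda>z. of_real pi * cos (of_real pi * z) / sin (of_real pi * z)) has_field_derivative
          - Polygamma 1 (1 - z) - Polygamma 1 z) (at z)"
    by (rule has_field_derivative_transform_within_open[OF _ open_S z dig])
  moreover have "((\<lambda>z. of_real pi * cot (of_real pi * z)) has_field_derivative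
          - (of_real pi)\<^sup>2 / (sin (of_real pi * z))\<^sup>2) (at z)"
    using rg_nz[OF z]
    by (auto intro!: derivative_eq_intros DERIV_chain2[OF DERIV_cot]
             simp: power2_eq_square field_simps)
  then have "((\<lambda>z. of_real pi * cos (of_real pi * z) / sin (of_real pi * z)) has_field_derivative
          - (of_real pi)\<^sup>2 / (sin (of_real pi * z))\<^sup>2) (at z)"
    by (simp only: cot_def times_divide_eq_right)
  ultimately have "- Polygamma 1 (1 - z) - Polygamma 1 z = - (of_real pi)\<^sup>2 / (sin (of_real pi * z))\<^sup>2"
    by (rule DERIV_unique)
  then have "Polygamma 1 z + Polygamma 1 (1 - z) = (of_real pi)\<^sup>2 / (sin (of_real pi * z))\<^sup>2"
    by (simp add: field_simps eq_neg_iff_add_eq_0)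
  also have "Polygamma 1 z + Polygamma 1 (1 - z) = of_real (Polygamma 1 x + Polygamma 1 (1 - x))"
    using x Polygamma_of_real[of x 1, where 'a = complex] Polygamma_of_real[of "1 - x" 1, where 'a = complex]
    by (simp add: z_def)
  also have "(of_real pi)\<^sup>2 / (sin (of_real pi * z))\<^sup>2 = of_real (pi\<^sup>2 / (sin (pi * x))\<^sup>2)"
    by (simp add: z_def sin_of_real flip: of_real_mult)
  finally show ?thesis by (simp only: of_real_eq_iff)
qed

section \<open>The identity for \<epsilon> = 1\<close>

lemma norm_sinc_square:
  "t \<noteq> 0 \<Longrightarrow> (norm_sinc t)\<^sup>2 = (sin (pi * t))\<^sup>2 / (pi\<^sup>2 * t\<^sup>2)"
  by (simp add: norm_sinc_def power_divide power_mult_distrib)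

lemma norm_sinc_0 [simp]: "norm_sinc 0 = 1"
  by (simp add: norm_sinc_def)

lemma sin_pi_plus_of_int_square: "(sin (pi * (x + of_int m)))\<^sup>2 = (sin (pi * x))\<^sup>2"
proof -
  have "sin (pi * of_int m) = 0" by (simp add: sin_zero_iff_int2)
  then have "sin (pi * (x + of_int m)) = sin (pi * x) * cos (pi * of_int m)"
    "(cos (pi * of_int m))\<^sup>2 = 1"
    by (simp_all add: ring_distribs sin_add cos_squared_eq)
  then show ?thesis by (simp only: power_mult_distrib mult_1_right)
qed

lemma has_sum_inverse_square_shift:
  fixes x :: real
  assumes "0 < x"
  shows "((\<lambda>k::nat. 1 / (x + of_nat k)\<^sup>2) has_sum Polygamma 1 x) UNIV"
proof (rule norm_summable_imp_has_sum)
  show *: "(\<lambda>k. 1 / (x + of_nat k)\<^sup>2) sums Polygamma 1 x"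
    using Polygamma_LIMSEQ[of x 1] assms by (simp add: inverse_eq_divide power2_eq_square)
  show "summable (\<lambda>k. norm (1 / (x + of_nat k)\<^sup>2))"
    using sums_summable[OF *] by simp
qed

text \<open>The numerator of the squared sinc is the same for all \<open>m\<close>, so only the sum
  of \<open>1 / (x + m)\<^sup>2\<close> matters. Its nonnegative and negative halves are the
  trigamma series at \<open>x\<close> and at \<open>1 - x\<close>, and the reflection formula adds
  them up.\<close>

lemma has_sum_norm_sinc_square_unit:
  fixes x :: real
  assumes x: "0 < x" "x < 1"
  shows "((\<lambda>m::int. (norm_sinc (x + of_int m))\<^sup>2) has_sum 1) UNIV"
proof -
  let ?f = "\<lambda>m::int. 1 / (x + of_int m)\<^sup>2"
  have "(?f has_sum Polygamma 1 x) {0..}"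
    using has_sum_inverse_square_shift[OF x(1)]
    by (rule iffD1[OF has_sum_reindex_bij_witness[where i = nat and j = int], rotated -1]) auto
  \<comment> \<open>The substitution \<open>m = - k - 1\<close> turns \<open>x + m\<close> into
    \<open>- ((1 - x) + k)\<close>, which has the same square.\<close>
  moreover have "(?f has_sum Polygamma 1 (1 - x)) {..<0}"
    using has_sum_inverse_square_shift[of "1 - x"] x
    by (intro iffD1[OF has_sum_reindex_bij_witness[where i = "\<lambda>m. nat (- m - 1)" and j = "\<lambda>k. - int k - 1"], rotated -1])
       (auto simp: power2_eq_square algebra_simps)
  ultimately have "(?f has_sum (Polygamma 1 x + Polygamma 1 (1 - x))) ({0..} \<union> {..<0})"
    by (rule has_sum_Un_disjoint) auto
  also have "{0..} \<union> {..<0} = (UNIV :: int set)" by auto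
  finally have "((\<lambda>m. ((sin (pi * x))\<^sup>2 / pi\<^sup>2) * ?f m) has_sum
      ((sin (pi * x))\<^sup>2 / pi\<^sup>2) * (pi\<^sup>2 / (sin (pi * x))\<^sup>2)) UNIV"
    unfolding trigamma_reflection[OF x] by (rule has_sum_cmult_right)
  moreover have "sin (pi * x) > 0" using x by (intro sin_gt_zero) auto
  moreover have "x + of_int m \<noteq> 0" for m :: int
    using x by (metis add.commute add_eq_0_iff of_int_0_less_iff of_int_less_1_iff
        neg_less_0_iff_less of_int_minus  zless_add1_eq  not_less_iff_gr_or_eq
        add_0 int_one_le_iff_zero_less linorder_not_le)
  ultimately show ?thesis
    by (simp add: norm_sinc_square sin_pi_plus_of_int_square)
qed

text \<open>At an integer \<open>x\<close> the sine kills every term except the one with argument 0.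
  Any other \<open>x\<close> is reduced to its fractional part by shifting \<open>m\<close>.\<close>

theorem has_sum_norm_sinc_square:
  fixes x :: real
  shows "((\<lambda>m::int. (norm_sinc (x + of_int m))\<^sup>2) has_sum 1) UNIV"
proof (cases "x \<in> \<int>")
  case True
  then obtain k where k: "x = of_int k" by (auto elim: Ints_cases)
  have "norm_sinc (x + of_int m) = 0" if "m \<noteq> - k" for m
  proof -
    have "sin (pi * (x + of_int m)) = 0"
      unfolding k by (simp add: sin_zero_iff_int2 flip: of_int_add)
    moreover have "x + of_int m \<noteq> 0"
      using that unfolding k by (simp flip: of_int_add)
    ultimately show ?thesis by (simp add: norm_sinc_def)
  qed
  then show ?thesis
    by (intro has_sum_finite_neutralI[where B = "{- k}"]) (auto simp: k)
next
  case False
  then have "0 < frac x" "frac x < 1" by (auto simp: frac_gt_0_iff frac_lt_1)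
  from has_sum_norm_sinc_square_unit[OF this] show ?thesis
    by (rule iffD1[OF has_sum_reindex_bij_witness[where i = "\<lambda>m. m + \<lfloor>x\<rfloor>" and j = "\<lambda>m. m - \<lfloor>x\<rfloor>"], rotated -1])
       (auto simp: frac_def algebra_simps)
qed

lemma cmod_cis_minus_1_square: "(cmod (cis t - 1))\<^sup>2 = 4 * (sin (t / 2))\<^sup>2"
proof -
  have "(cmod (cis t - 1))\<^sup>2 = 2 - 2 * cos t"
    by (simp add: cmod_power2 power2_diff sin_squared_eq)
  also have "cos t = 1 - 2 * (sin (t / 2))\<^sup>2"
    using cos_double_sin[of "t / 2"] by simp
  finally show ?thesis by simp
qed

text \<open>The Dirichlet kernel turns a dilation by a positive integer into a finite
  trigonometric factor; stating it for all \<open>s\<close> avoids a case split at the integers.\<close>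
lemma norm_sinc_square_dilate:
  "(real a)\<^sup>2 * (norm_sinc (real a * s))\<^sup>2 =
     (norm_sinc s)\<^sup>2 * (cmod (\<Sum>j<a. cis (2 * pi * real j * s)))\<^sup>2"
proof (cases "a = 0 \<or> s = 0")
  case True
  then show ?thesis by auto
next
  case False
  show ?thesis
  \<comment> \<open>At a nonzero integer \<open>s\<close> both sides vanish; elsewhere the
    exponential sum is a geometric series whose ratio \<open>z\<close> is not 1.\<close>
  proof (cases "sin (pi * s) = 0")
    case True
    then obtain i :: int where "pi * s = of_int i * pi" by (auto simp: sin_zero_iff_int2)
    then have "s = of_int i" by simp
    then have "sin (pi * (real a * s)) = 0"
      by (auto simp: sin_zero_iff_int2 intro: exI[of _ "int a * i"])
    then show ?thesis using False True by (simp add: norm_sinc_square)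
  next
    case ns: False
    define z where "z = cis (2 * pi * s)"
    have z1: "(cmod (z - 1))\<^sup>2 = 4 * (sin (pi * s))\<^sup>2"
      unfolding z_def cmod_cis_minus_1_square by simp
    have za: "(cmod (z ^ a - 1))\<^sup>2 = 4 * (sin (pi * (real a * s)))\<^sup>2"
      unfolding z_def Complex.DeMoivre cmod_cis_minus_1_square by (simp add: mult_ac)
    have "z \<noteq> 1" using z1 ns by auto
    have "(\<Sum>j<a. cis (2 * pi * real j * s)) = (\<Sum>j<a. z ^ j)"
      by (simp add: z_def Complex.DeMoivre mult_ac)
    also have "\<dots> = (z ^ a - 1) / (z - 1)"
      using \<open>z \<noteq> 1\<close> by (simp add: geometric_sum)
    finally have "(cmod (\<Sum>j<a. cis (2 * pi * real j * s)))\<^sup>2 =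
        (sin (pi * (real a * s)))\<^sup>2 / (sin (pi * s))\<^sup>2"
      by (simp add: norm_divide power_divide z1 za)
    then show ?thesis
      using False ns by (simp add: norm_sinc_square power_mult_distrib field_simps)
  qed
qed

section \<open>Fejer kernels and rational \<epsilon>\<close>

lemma cmod_sum_square:
  "of_real ((cmod (\<Sum>j\<in>A. f j))\<^sup>2) = (\<Sum>j\<in>A. \<Sum>k\<in>A. f j * cnj (f k))"
  unfolding complex_norm_square cnj_sum by (rule sum_product)

text \<open>Expanding the square gives pairs \<open>j\<close>, \<open>k\<close>. For each pair the
  sum over \<open>r\<close> runs through the powers of an \<open>N\<close>-th root of unity and
  vanishes unless that root is 1, so only the \<open>a\<close> diagonal pairs contribute,
  \<open>N\<close> each.\<close>

lemma sum_Fejer_kernel: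
  fixes x :: real
  assumes "a \<le> N"
  shows "(\<Sum>r<N. (cmod (\<Sum>j<a. cis (2 * pi * real j * ((x + real r) / real N))))\<^sup>2) = real N * real a"
    (is "?L = _")
proof -
  have inner: "(\<Sum>r<N. cis (2 * pi * real j * ((x + real r) / real N)) *
      cnj (cis (2 * pi * real k * ((x + real r) / real N)))) = (if j = k then of_nat N else 0)"
    if jk: "j < a" "k < a" for j k
  proof -
    define w where "w = cis (2 * pi * (real j - real k) / real N)"
    have N: "N > 0" using jk assms by auto
    have "(\<Sum>r<N. cis (2 * pi * real j * ((x + real r) / real N)) *
        cnj (cis (2 * pi * real k * ((x + real r) / real N)))) =
        (\<Sum>r<N. cis (2 * pi * (real j - real k) * x / real N) * w ^ r)"
      unfolding w_def Complex.DeMoivre cis_cnj cis_mult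
      by (intro sum.cong refl arg_cong[where f = cis]) (use N in \<open>auto simp: cis_mult diff_divide_distrib add_divide_distrib algebra_simps\<close>)
    also have "\<dots> = cis (2 * pi * (real j - real k) * x / real N) * (\<Sum>r<N. w ^ r)"
      by (simp add: sum_distrib_left)
    also have "\<dots> = (if j = k then of_nat N else 0)"
    proof (cases "j = k")
      case False
      have "w \<noteq> 1"
      proof
        assume "w = 1"
        then have "(cmod (w - 1))\<^sup>2 = 0" by simp
        then have "sin (pi * (real j - real k) / real N) = 0"
          unfolding w_def cmod_cis_minus_1_square by simp
        then obtain i :: int where "pi * (real j - real k) / real N = of_int i * pi"
          by (auto simp: sin_zero_iff_int2)
        then have "pi * ((real j - real k) / real N) = pi * of_int i"
          by (simp only: mult.commute times_divide_eq_right)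
        then have "(real j - real k) / real N = of_int i"
          by (rule mult_left_cancel[OF pi_neq_zero, THEN iffD1])
        then have "real j - real k = of_int i * real N"
          using N by (simp add: field_simps)
        then have "of_int (int j - int k) = (of_int (i * int N) :: real)" by simp
        then have eq: "int j - int k = i * int N" by (simp only: of_int_eq_iff)
        \<comment> \<open>The hypothesis \<open>a \<le> N\<close> makes distinct indices below
          \<open>a\<close> incongruent modulo \<open>N\<close>; a larger \<open>a\<close> would
          bring in off-diagonal terms.\<close>
        have "\<bar>int j - int k\<bar> < int N" using jk assms by auto
        then have "\<bar>i\<bar> * int N < 1 * int N" unfolding eq by (simp add: abs_mult)
        then have "\<bar>i\<bar> < 1" by (rule mult_right_less_imp_less) simp
        then show False using eq False by simp
      qed
      moreover have "w ^ N = 1"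
      proof -
        have "w ^ N = cis (2 * pi * of_int (int j - int k))"
          unfolding w_def Complex.DeMoivre using N by simp
        also have "\<dots> = 1" by (rule cis_multiple_2pi) auto
        finally show ?thesis .
      qed
      ultimately show ?thesis using False by (simp add: geometric_sum)
    qed (simp add: w_def)
    finally show ?thesis .
  qed
  have "complex_of_real ?L = (\<Sum>r<N. \<Sum>j<a. \<Sum>k<a. cis (2 * pi * real j * ((x + real r) / real N)) *
      cnj (cis (2 * pi * real k * ((x + real r) / real N))))"
    by (simp only: of_real_sum cmod_sum_square)
  also have "\<dots> = (\<Sum>j<a. \<Sum>k<a. \<Sum>r<N. cis (2 * pi * real j * ((x + real r) / real N)) *
      cnj (cis (2 * pi * real k * ((x + real r) / real N))))"
    by (subst sum.swap, subst (2) sum.swap) (rule refl)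
  also have "\<dots> = (\<Sum>j<a. \<Sum>k<a. if j = k then of_nat N else 0)"
    by (intro sum.cong refl inner) auto
  also have "\<dots> = of_real (real N * real a)"
    by simp
  finally show ?thesis by (simp only: of_real_eq_iff)
qed

text \<open>Writing the summation index as \<open>r + N * m\<close> with \<open>r < N\<close> makes
  the argument \<open>a\<close> times \<open>(x + r) / N + m\<close>. By the dilation formula a term
  is then a squared sinc at unit spacing times a factor that is periodic in
  \<open>m\<close>.\<close>

lemma has_sum_norm_sinc_square_rational:
  fixes x :: real
  assumes a: "0 < a" "a \<le> N"
  shows "((\<lambda>m::int. (norm_sinc (real a / real N * (x + of_int m)))\<^sup>2) has_sum real N / real a) UNIV"
proof -
  \<comment> \<open>The contribution of the residue class of \<open>r\<close>: the squared sincs in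
    it sum to 1, which leaves the Fejer factor.\<close>
  let ?K = "\<lambda>r. (cmod (\<Sum>j<a. cis (2 * pi * real j * ((x + real r) / real N))))\<^sup>2 / (real a)\<^sup>2"
  let ?f = "\<lambda>(r, m). (norm_sinc (real a / real N * (x + of_int (int r + int N * m))))\<^sup>2"
  have N: "N > 0" using a by simp
  have "(?f has_sum real N / real a) ({..<N} \<times> UNIV)"
  proof (rule has_sum_Sigma_nonneg)
    fix r
    have eq: "(norm_sinc (real a / real N * (x + of_int (int r + int N * m))))\<^sup>2 =
        ?K r * (norm_sinc ((x + real r) / real N + of_int m))\<^sup>2" for m :: int
    proof -
      let ?s = "(x + real r) / real N + of_int m"
      have "real a / real N * (x + of_int (int r + int N * m)) = real a * ?s"
        using N by (simp add: field_simps)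
      moreover have "cis (2 * pi * real j * ?s) = cis (2 * pi * real j * ((x + real r) / real N))" for j
      proof -
        have "cis (2 * pi * real j * ?s) = cis (2 * pi * real j * ((x + real r) / real N)) *
            cis (2 * pi * of_int (int j * m))"
          by (simp add: cis_mult algebra_simps)
        also have "cis (2 * pi * of_int (int j * m)) = 1" by (rule cis_multiple_2pi) auto
        finally show ?thesis by simp
      qed
      ultimately show ?thesis
        using norm_sinc_square_dilate[of a ?s] a by (simp add: field_simps)
    qed
    show "((\<lambda>m. ?f (r, m)) has_sum ?K r) UNIV"
      using has_sum_cmult_right[OF has_sum_norm_sinc_square, of "?K r"] by (simp only: prod.case eq mult_1_right)
  next
    have "(\<Sum>r<N. ?K r) = real N * real a / (real a)\<^sup>2"
      using sum_Fejer_kernel[OF a(2)] by (simp flip: sum_divide_distrib)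
    then show "(?K has_sum real N / real a) {..<N}"
      using a by (intro has_sum_finiteI) (auto simp: power2_eq_square)
  qed auto
  moreover have "bij_betw (\<lambda>(r, m). int r + int N * m) ({..<N} \<times> UNIV) UNIV"
    by (rule bij_betwI[where g = "\<lambda>m. (nat (m mod int N), m div int N)"])
       (use N in \<open>auto simp: nat_less_iff\<close>)
  ultimately show ?thesis
    using has_sum_reindex_bij_betw[where g = "\<lambda>(r, m). int r + int N * m" and A = "{..<N} \<times> UNIV" and B = UNIV and
        f = "\<lambda>m. (norm_sinc (real a / real N * (x + of_int m)))\<^sup>2"]
    by (simp only: case_prod_unfold)
qed

section \<open>From rational to real \<epsilon>\<close>

lemma abs_norm_sinc_le_1: "\<bar>norm_sinc t\<bar> \<le> 1"
  using abs_sin_x_le_abs_x[of "pi * t"] by (simp add: norm_sinc_def abs_mult)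

text \<open>The extra factor \<epsilon> cancels the \<epsilon> in the denominator of the sinc,
  leaving a sine over a constant when \<open>t \<noteq> 0\<close>.\<close>

lemma continuous_on_scaled_norm_sinc_square:
  "continuous_on {0<..1} (\<lambda>\<epsilon>. (\<epsilon> * norm_sinc (\<epsilon> * t))\<^sup>2)"
proof (cases "t = 0")
  case False
  have "(\<epsilon> * norm_sinc (\<epsilon> * t))\<^sup>2 = (sin (pi * (\<epsilon> * t)) / (pi * t))\<^sup>2" if "\<epsilon> \<in> {0<..1}" for \<epsilon>
    using that False by (simp add: norm_sinc_def)
  then show ?thesis
    by (subst continuous_on_cong[OF refl]) (auto intro!: continuous_intros simp: False)
qed (auto intro!: continuous_intros)

text \<open>After multiplication by the square of \<epsilon>, the terms have a summable majorant
  that does not depend on \<epsilon>. By the Weierstrass test their sum is continuous on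
  \<open>{0<..1}\<close>, and it equals \<epsilon> at the rationals there, hence everywhere.\<close>

theorem has_sum_norm_sinc_square_scaled:
  fixes x \<epsilon> :: real
  assumes \<epsilon>: "0 < \<epsilon>" "\<epsilon> \<le> 1"
  shows "((\<lambda>m::int. (norm_sinc (\<epsilon> * (x + of_int m)))\<^sup>2) has_sum 1 / \<epsilon>) UNIV"
proof -
  let ?g = "\<lambda>m::int. \<lambda>\<epsilon>. (\<epsilon> * norm_sinc (\<epsilon> * (x + of_int m)))\<^sup>2"
  \<comment> \<open>The majorant uses the half-integers \<open>u = 1/2 + m\<close>, which never
    vanish and where the squared sinc is exactly \<open>1 / (pi\<^sup>2 * u\<^sup>2)\<close>. With
    \<open>t = x + m\<close> and \<open>q\<close> the term itself, \<open>q \<le> 1\<close> and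
    \<open>q * t\<^sup>2 \<le> 1\<close> combine with
    \<open>u\<^sup>2 \<le> 2 * t\<^sup>2 + 2 * (1/2 - x)\<^sup>2\<close> to bound
    \<open>q * u\<^sup>2\<close> by \<open>C / pi\<^sup>2\<close>.\<close>
  define C where "C = (2 + 2 * (1/2 - x)\<^sup>2) * pi\<^sup>2"
  let ?M = "\<lambda>m::int. C * (norm_sinc (1/2 + of_int m))\<^sup>2"
  have M: "?M summable_on UNIV"
    using has_sum_imp_summable[OF has_sum_norm_sinc_square] by (rule summable_on_cmult_right)
  have bound: "norm (?g m e) \<le> ?M m" if "e \<in> {0<..1}" for m e
  proof -
    define t where "t = x + of_int m"
    define u where "u = 1/2 + (of_int m :: real)"
    define q where "q = (e * norm_sinc (e * t))\<^sup>2"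
    have q1: "q \<le> 1"
      using that abs_norm_sinc_le_1[of "e * t"] unfolding q_def abs_square_le_1
      by (auto simp: abs_mult intro: mult_le_one)
    have q2: "q * t\<^sup>2 \<le> 1"
    proof (cases "t = 0")
      case False
      then have "q * t\<^sup>2 = (sin (pi * (e * t)) / pi)\<^sup>2"
        using that by (simp add: q_def norm_sinc_def power_divide power_mult_distrib)
      also have "\<dots> \<le> 1"
        using abs_sin_le_one[of "pi * (e * t)"] pi_gt3 unfolding abs_square_le_1
        by (simp add: divide_le_eq del: abs_sin_le_one)
      finally show ?thesis .
    qed simp
    have "u = t + (1/2 - x)" by (simp add: u_def t_def)
    then have "u\<^sup>2 \<le> 2 * t\<^sup>2 + 2 * (1/2 - x)\<^sup>2"
      using sum_squares_bound[of t "1/2 - x"] by (simp add: power2_sum)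
    then have "q * u\<^sup>2 \<le> q * (2 * t\<^sup>2 + 2 * (1/2 - x)\<^sup>2)"
      by (rule mult_left_mono) (simp add: q_def)
    also have "\<dots> \<le> 2 + 2 * (1/2 - x)\<^sup>2"
      using q2 mult_right_mono[OF q1, of "2 * (1/2 - x)\<^sup>2"] by (simp add: algebra_simps)
    finally have "q * u\<^sup>2 \<le> 2 + 2 * (1/2 - x)\<^sup>2" .
    moreover have "u \<noteq> 0"
    proof
      assume "u = 0"
      then have "of_int (2 * m + 1) = (0::real)" by (simp add: u_def)
      then have "2 * m + 1 = 0" by (simp only: of_int_eq_0_iff)
      then show False by presburger
    qed
    moreover from this have "C * (norm_sinc u)\<^sup>2 = (2 + 2 * (1/2 - x)\<^sup>2) / u\<^sup>2"
      unfolding C_def using sin_pi_plus_of_int_square[of "1/2" m] by (simp add: norm_sinc_square u_def)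
    ultimately have "q \<le> C * (norm_sinc u)\<^sup>2"
      by (simp add: le_divide_eq)
    then show ?thesis by (simp add: q_def u_def t_def)
  qed
  have summ: "(\<lambda>m. ?g m e) summable_on UNIV" if "e \<in> {0<..1}" for e
    using M by (rule summable_on_comparison_test) (use bound[OF that] in auto)
  have cont: "continuous_on {0<..1} (\<lambda>e. \<Sum>\<^sub>\<infinity>m. ?g m e)"
  proof (rule uniform_limit_theorem)
    show "uniform_limit {0<..1} (\<lambda>X e. \<Sum>m\<in>X. ?g m e) (\<lambda>e. \<Sum>\<^sub>\<infinity>m. ?g m e) (finite_subsets_at_top UNIV)"
      using bound M by (rule Weierstrass_m_test_general)
    show "\<forall>\<^sub>F X in finite_subsets_at_top UNIV. continuous_on {0<..1} (\<lambda>e. \<Sum>m\<in>X. ?g m e)"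
      by (intro always_eventually allI continuous_on_sum continuous_on_scaled_norm_sinc_square)
  qed simp
  have rat: "(\<Sum>\<^sub>\<infinity>m. ?g m (real a / real N)) = real a / real N" if "0 < a" "a \<le> N" for a N
    using has_sum_cmult_right[OF has_sum_norm_sinc_square_rational[OF that], of "(real a / real N)\<^sup>2" x] that
    by (intro infsumI) (simp add: power2_eq_square mult_ac)
  \<comment> \<open>Rounding up keeps the numerator positive, and \<epsilon> \<le> 1 keeps it at
    most \<open>Suc n\<close>, so every \<open>s n\<close> is a rational in
    \<open>{0<..1}\<close>.\<close>
  define s where "s n = real (nat \<lceil>\<epsilon> * real (Suc n)\<rceil>) / real (Suc n)" for n
  have num: "0 < nat \<lceil>\<epsilon> * real (Suc n)\<rceil>" "nat \<lceil>\<epsilon> * real (Suc n)\<rceil> \<le> Suc n" for n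
  proof -
    have "0 < \<epsilon> * real (Suc n)" using \<epsilon> by simp
    then show "0 < nat \<lceil>\<epsilon> * real (Suc n)\<rceil>" by (simp only: zero_less_nat_eq zero_less_ceiling)
    have "\<lceil>\<epsilon> * real (Suc n)\<rceil> \<le> int (Suc n)"
      using mult_right_mono[OF \<epsilon>(2), of "real (Suc n)"] by (intro ceiling_le) simp
    then show "nat \<lceil>\<epsilon> * real (Suc n)\<rceil> \<le> Suc n" by (simp only: nat_le_iff)
  qed
  have s: "s n \<in> {0<..1}" for n
  proof -
    have "real a / real N \<in> {0<..1}" if "0 < a" "a \<le> N" for a N
      using that by auto
    then show ?thesis unfolding s_def using num by blast
  qed
  have lim: "s \<longlonglongrightarrow> \<epsilon>"
  proof (rule real_tendsto_sandwich)
    have "0 \<le> \<lceil>\<epsilon> * real (Suc n)\<rceil>" for n using num(1)[of n] by linarith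
    then have c: "real (nat \<lceil>\<epsilon> * real (Suc n)\<rceil>) = of_int \<lceil>\<epsilon> * real (Suc n)\<rceil>" for n
      by (metis of_int_of_nat_eq int_nat_eq)
    show "\<forall>\<^sub>F n in sequentially. \<epsilon> \<le> s n"
      unfolding s_def c by (simp add: le_divide_eq del: of_nat_Suc)
    have "s n \<le> \<epsilon> + inverse (real (Suc n))" for n
    proof -
      have "s n \<le> (\<epsilon> * real (Suc n) + 1) / real (Suc n)"
        unfolding s_def c by (intro divide_right_mono) linarith+
      also have "\<dots> = \<epsilon> + inverse (real (Suc n))" by (simp add: field_simps)
      finally show ?thesis .
    qed
    then show "\<forall>\<^sub>F n in sequentially. s n \<le> \<epsilon> + inverse (real (Suc n))" by simp
    show "(\<lambda>n. \<epsilon> + inverse (real (Suc n))) \<longlonglongrightarrow> \<epsilon>"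
      using tendsto_add[OF tendsto_const LIMSEQ_inverse_real_of_nat, of \<epsilon>] by simp
  qed simp
  have "(\<lambda>n. \<Sum>\<^sub>\<infinity>m. ?g m (s n)) \<longlonglongrightarrow> (\<Sum>\<^sub>\<infinity>m. ?g m \<epsilon>)"
    using cont lim by (rule continuous_on_tendsto_compose) (use \<epsilon> s in auto)
  moreover have "(\<Sum>\<^sub>\<infinity>m. ?g m (s n)) = s n" for n
    unfolding s_def by (rule rat[OF num])
  ultimately have "s \<longlonglongrightarrow> (\<Sum>\<^sub>\<infinity>m. ?g m \<epsilon>)" by simp
  then have "(\<Sum>\<^sub>\<infinity>m. ?g m \<epsilon>) = \<epsilon>"
    using lim LIMSEQ_unique by blast
  then have "((\<lambda>m. ?g m \<epsilon>) has_sum \<epsilon>) UNIV"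
    using summ[of \<epsilon>] \<epsilon> by (simp add: has_sum_iff)
  from has_sum_cmult_right[OF this, of "1 / \<epsilon>\<^sup>2"] show ?thesis
    using \<epsilon> by (simp add: power_mult_distrib power2_eq_square)
qed

section \<open>Subgroups and their transversals\<close>

definition add_subgroup :: "'a::ab_group_add set \<Rightarrow> bool" where
  "add_subgroup K \<longleftrightarrow> 0 \<in> K \<and> (\<forall>x\<in>K. \<forall>y\<in>K. x - y \<in> K)"

lemma add_subgroup_0: "add_subgroup K \<Longrightarrow> 0 \<in> K"
  by (simp add: add_subgroup_def)

lemma add_subgroup_diff: "add_subgroup K \<Longrightarrow> x \<in> K \<Longrightarrow> y \<in> K \<Longrightarrow> x - y \<in> K"
  unfolding add_subgroup_def by blast

lemma add_subgroup_uminus: "add_subgroup K \<Longrightarrow> x \<in> K \<Longrightarrow> - x \<in> K"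
  using add_subgroup_diff[of K 0 x] by (simp add: add_subgroup_0)

lemma add_subgroup_add: "add_subgroup K \<Longrightarrow> x \<in> K \<Longrightarrow> y \<in> K \<Longrightarrow> x + y \<in> K"
  using add_subgroup_diff[OF _ _ add_subgroup_uminus, of K x y] by simp

lemma add_subgroup_sum:
  assumes "add_subgroup K" "\<And>i. i \<in> I \<Longrightarrow> f i \<in> K"
  shows "sum f I \<in> K"
  using assms by (induction I rule: infinite_finite_induct) (auto intro: add_subgroup_add simp: add_subgroup_0)

lemma add_subgroup_scaleR:
  fixes x :: "'a::real_vector"
  assumes "add_subgroup K" "x \<in> K"
  shows "of_int j *\<^sub>R x \<in> K"
proof (induction j rule: int_induct[where k = 0])
  case base
  then show ?case using assms by (simp add: add_subgroup_0)
next
  case (step1 j)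
  then show ?case using assms by (simp add: scaleR_add_left add_subgroup_add)
next
  case (step2 j)
  then show ?case using assms by (simp add: scaleR_diff_left add_subgroup_diff)
qed

section \<open>Integer points and dual lattices\<close>

lemma add_subgroup_int_points: "add_subgroup int_points"
  by (auto simp: add_subgroup_def int_points_def)

lemma add_subgroup_dual_lattice: "add_subgroup (dual_lattice L)"
  by (auto simp: add_subgroup_def dual_lattice_def inner_diff_left)

lemma full_rank_sublattice_add_subgroup: "full_rank_sublattice L \<Longrightarrow> add_subgroup L"
  unfolding add_subgroup_def full_rank_sublattice_def by blast

lemma inner_int_points: "x \<in> int_points \<Longrightarrow> y \<in> int_points \<Longrightarrow> x \<bullet> y \<in> \<int>"
  by (auto simp: int_points_def inner_vec_def intro!: Ints_sum Ints_mult)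

lemma axis_int_points: "axis i 1 \<in> int_points"
  by (auto simp: int_points_def axis_def)

text \<open>Pairing with the unit vectors reads off the coordinates.\<close>

lemma dual_lattice_int_points: "dual_lattice int_points = int_points"
proof
  show "int_points \<subseteq> dual_lattice int_points"
    by (auto simp: dual_lattice_def inner_int_points)
  show "dual_lattice int_points \<subseteq> int_points"
    using axis_int_points by (fastforce simp: dual_lattice_def int_points_def inner_axis)
qed

lemma dual_lattice_antimono: "K \<subseteq> L \<Longrightarrow> dual_lattice L \<subseteq> dual_lattice K"
  by (auto simp: dual_lattice_def)

lemma span_int_points: "span int_points = (UNIV :: (real ^ 'd) set)"
proof -
  have "(Basis :: (real ^ 'd) set) \<subseteq> int_points"
    by (auto simp: Basis_vec_def axis_int_points)
  then have "span (Basis :: (real ^ 'd) set) \<subseteq> span int_points"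
    by (rule span_mono)
  then show ?thesis by auto
qed

text \<open>Representatives take the place of the quotient of \<open>M\<close> by \<open>K\<close>,
  so that sums over cosets become sums over vectors.\<close>

definition transversal :: "'a::ab_group_add set \<Rightarrow> 'a set \<Rightarrow> 'a set \<Rightarrow> bool" where
  "transversal M K R \<longleftrightarrow> R \<subseteq> M \<and> (\<forall>x\<in>M. \<exists>!r. r \<in> R \<and> x - r \<in> K)"

lemma coset_eq_iff:
  assumes "add_subgroup K"
  shows "(+) x ` K = (+) y ` K \<longleftrightarrow> x - y \<in> K"
proof
  assume eq: "(+) x ` K = (+) y ` K"
  have "x \<in> (+) x ` K" using add_subgroup_0[OF assms] by force
  then show "x - y \<in> K" unfolding eq by auto
next
  assume xy: "x - y \<in> K"
  have "x + k \<in> (+) y ` K" if "k \<in> K" for k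
    using add_subgroup_add[OF assms xy that] by (rule rev_image_eqI) simp
  moreover have "y + k \<in> (+) x ` K" if "k \<in> K" for k
    using add_subgroup_diff[OF assms that xy] by (rule rev_image_eqI) simp
  ultimately show "(+) x ` K = (+) y ` K" by blast
qed

lemma transversal_exists:
  assumes "add_subgroup K"
  obtains R where "transversal M K R"
proof -
  define rep where "rep C = (SOME x. x \<in> M \<and> (+) x ` K = C)" for C
  let ?R = "rep ` (\<lambda>x. (+) x ` K) ` M"
  have rep: "rep ((+) x ` K) \<in> M \<and> (+) (rep ((+) x ` K)) ` K = (+) x ` K" if "x \<in> M" for x
    unfolding rep_def by (rule someI[of _ x]) (use that in auto)
  have "transversal M K ?R"
    unfolding transversal_def coset_eq_iff[OF assms, symmetric]
  proof (intro conjI ballI)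
    show "\<exists>!r. r \<in> ?R \<and> (+) x ` K = (+) r ` K" if "x \<in> M" for x
    proof
      show "rep ((+) x ` K) \<in> ?R \<and> (+) x ` K = (+) (rep ((+) x ` K)) ` K"
        using rep[OF that] that by auto
      show "r = rep ((+) x ` K)" if "r \<in> ?R \<and> (+) x ` K = (+) r ` K" for r
        using that rep by auto
    qed
  qed (use rep in auto)
  then show ?thesis by (rule that)
qed

text \<open>Connects \<open>lattice_det\<close>, which counts cosets, with the size of a system of
  representatives.\<close>

lemma card_transversal:
  assumes "add_subgroup K" "transversal M K R"
  shows "card ((\<lambda>x. (+) x ` K) ` M) = card R"
proof -
  let ?c = "\<lambda>x. (+) x ` K"
  have "?c ` M = ?c ` R"
  proof
    show "?c ` M \<subseteq> ?c ` R"
    proof safe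
      fix x assume "x \<in> M"
      then obtain r where "r \<in> R" "x - r \<in> K"
        using assms(2) unfolding transversal_def by blast
      then have "?c x = ?c r" by (simp only: coset_eq_iff[OF assms(1)])
      then show "?c x \<in> ?c ` R" using \<open>r \<in> R\<close> by simp
    qed
    show "?c ` R \<subseteq> ?c ` M"
      using assms(2) by (auto simp: transversal_def)
  qed
  moreover have "inj_on ?c R"
  proof (rule inj_onI)
    fix r s assume rs: "r \<in> R" "s \<in> R" and "?c r = ?c s"
    then have "r - s \<in> K" by (simp only: coset_eq_iff[OF assms(1)])
    moreover have "r \<in> M" using rs assms(2) by (auto simp: transversal_def)
    ultimately show "r = s"
      using rs assms(2) add_subgroup_0[OF assms(1)] unfolding transversal_def by (metis diff_self)
  qed
  ultimately show ?thesis by (simp add: card_image)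
qed

text \<open>Used to split a sum over the dual lattice into a finite sum over representatives and a
  sum over the integer points.\<close>

lemma bij_betw_transversal:
  assumes M: "add_subgroup M" and K: "add_subgroup K" "K \<subseteq> M" and R: "transversal M K R"
  shows "bij_betw (\<lambda>(r, k). r + k) (R \<times> K) M"
  unfolding bij_betw_def
proof
  have uniq: "r = s" if "r \<in> R" "s \<in> R" "x - r \<in> K" "x - s \<in> K" "x \<in> M" for r s x
    using R that unfolding transversal_def by blast
  have RM: "R \<subseteq> M" using R by (simp add: transversal_def)
  show "inj_on (\<lambda>(r, k). r + k) (R \<times> K)"
  proof (rule inj_onI, safe)
    fix r k s l assume *: "r \<in> R" "k \<in> K" "s \<in> R" "l \<in> K" "r + k = s + l"
    have "r + k - r \<in> K" using *(2) by simp
    moreover have "r + k - s \<in> K" using *(4) by (simp add: *(5))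
    moreover have "r + k \<in> M" using * K RM add_subgroup_add[OF M] by blast
    ultimately show "r = s" using uniq * by blast
    then show "k = l" using * by simp
  qed
  show "(\<lambda>(r, k). r + k) ` (R \<times> K) = M"
  proof safe
    fix r k assume "r \<in> R" "k \<in> K"
    then show "r + k \<in> M" using K RM add_subgroup_add[OF M] by blast
  next
    fix x assume "x \<in> M"
    then obtain r where "r \<in> R" "x - r \<in> K" using R unfolding transversal_def by blast
    then show "x \<in> (\<lambda>(r, k). r + k) ` (R \<times> K)" by (intro image_eqI[of _ _ "(r, x - r)"]) auto
  qed
qed

text \<open>Choose a basis inside \<open>K\<close> and round the coordinates of \<open>x\<close>
  down. The remainder lies in the fundamental parallelepiped of that basis, whose points have norm
  at most the sum of the norms of the basis vectors.\<close>

lemma bounded_remainder: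
  fixes K :: "'a::euclidean_space set"
  assumes K: "add_subgroup K" and "span K = UNIV"
  obtains c where "\<And>x. \<exists>k\<in>K. norm (x - k) \<le> c"
proof -
  obtain B where B: "B \<subseteq> K" "independent B" "K \<subseteq> span B"
    using maximal_independent_subset by metis
  have fin: "finite B" using B(2) by (rule independent_imp_finite)
  have "span K \<subseteq> span B" using B(3) by (metis span_minimal subspace_span)
  then have span: "span B = UNIV" using assms(2) by blast
  have "\<exists>k\<in>K. norm (x - k) \<le> (\<Sum>b\<in>B. norm b)" for x
  proof -
    have "x \<in> span B" using span by simp
    then obtain u where u: "x = (\<Sum>b\<in>B. u b *\<^sub>R b)"
      unfolding span_finite[OF fin] by auto
    let ?k = "\<Sum>b\<in>B. of_int \<lfloor>u b\<rfloor> *\<^sub>R b"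
    have "?k \<in> K" using B(1) K by (intro add_subgroup_sum add_subgroup_scaleR) auto
    moreover have "x - ?k = (\<Sum>b\<in>B. frac (u b) *\<^sub>R b)"
      by (simp add: u frac_def scaleR_diff_left sum_subtractf)
    moreover have "norm (\<Sum>b\<in>B. frac (u b) *\<^sub>R b) \<le> (\<Sum>b\<in>B. norm b)"
    proof (rule sum_norm_le)
      show "norm (frac (u b) *\<^sub>R b) \<le> norm b" for b
        using frac_lt_1[of "u b"] by (simp add: mult_left_le_one_le)
    qed
    ultimately show ?thesis by metis
  qed
  then show ?thesis by (rule that)
qed

text \<open>A vector is determined by its inner products with a basis chosen from \<open>B\<close>.
  For a dual vector these are integers, and Cauchy-Schwarz bounds them, so only finitely many tuples
  occur.\<close>

lemma finite_bounded_dual_lattice: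
  fixes B :: "(real ^ 'd) set"
  assumes "span B = UNIV"
  shows "finite {x \<in> dual_lattice B. norm x \<le> c}"
proof -
  obtain B' where B': "B' \<subseteq> B" "independent B'" "B \<subseteq> span B'"
    using maximal_independent_subset by metis
  have fin: "finite B'" using B'(2) by (rule independent_imp_finite)
  have "span B \<subseteq> span B'" using B'(3) by (metis span_minimal subspace_span)
  then have span: "span B' = UNIV" using assms by blast
  let ?X = "{x \<in> dual_lattice B. norm x \<le> c}"
  let ?g = "\<lambda>x. restrict ((\<bullet>) x) B'"
  let ?Z = "\<lambda>b. {z \<in> \<int>. \<bar>z\<bar> \<le> c * norm b}"
  have "finite (?Z b)" for b by (rule finite_abs_int_segment)
  then have "finite (PiE B' ?Z)" using fin by (intro finite_PiE)
  moreover have "?g ` ?X \<subseteq> PiE B' ?Z"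
  proof (intro image_subsetI PiE_I)
    fix x b assume x: "x \<in> ?X" and b: "b \<in> B'"
    have "\<bar>x \<bullet> b\<bar> \<le> norm x * norm b" by (rule Cauchy_Schwarz_ineq2)
    also have "\<dots> \<le> c * norm b" using x by (intro mult_right_mono) auto
    finally show "?g x b \<in> ?Z b" using x b B'(1) by (auto simp: dual_lattice_def)
  qed auto
  moreover have "inj_on ?g ?X"
  proof (rule inj_onI)
    fix x y assume eq: "?g x = ?g y"
    have "(x - y) \<bullet> b = 0" if "b \<in> B'" for b
      using fun_cong[OF eq, of b] that by (simp add: inner_diff_left)
    then have "orthogonal (x - y) b" if "b \<in> B'" for b
      using that unfolding orthogonal_def by blast
    then have "orthogonal (x - y) z" if "z \<in> span B'" for z
      by (rule orthogonal_to_span[OF that])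
    then have "orthogonal (x - y) (x - y)" unfolding span by blast
    then have "(x - y) \<bullet> (x - y) = 0" by (simp only: orthogonal_def)
    then show "x = y" by simp
  qed
  ultimately show ?thesis using inj_on_finite by blast
qed

text \<open>Reducing representatives modulo \<open>K\<close> makes them uniformly bounded without
  merging different cosets, so they inject into a finite set. The set \<open>B\<close> witnesses
  that \<open>M\<close> is discrete; it is \<open>L\<close> when \<open>M\<close> is the dual
  lattice, and the integer points when \<open>M\<close> is the integer points.\<close>

lemma finite_transversal:
  fixes M K R B :: "(real ^ 'd) set"
  assumes M: "add_subgroup M" "M \<subseteq> dual_lattice B" "span B = UNIV"
    and K: "add_subgroup K" "K \<subseteq> M" "span K = UNIV" and R: "transversal M K R"
  shows "finite R"
proof -
  obtain c where "\<And>x. \<exists>k\<in>K. norm (x - k) \<le> c"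
    using bounded_remainder K by metis
  then obtain \<kappa> where \<kappa>: "\<And>x. \<kappa> x \<in> K" "\<And>x. norm (x - \<kappa> x) \<le> c" by metis
  have RM: "R \<subseteq> M" using R by (simp add: transversal_def)
  have inM: "r - \<kappa> r \<in> M" if "r \<in> R" for r
    using that RM K \<kappa>(1) M(1) by (intro add_subgroup_diff) auto
  have sub: "(\<lambda>r. r - \<kappa> r) ` R \<subseteq> {x \<in> dual_lattice B. norm x \<le> c}"
    using inM M(2) \<kappa>(2) by auto
  have inj: "inj_on (\<lambda>r. r - \<kappa> r) R"
  proof (rule inj_onI)
    fix r s assume rs: "r \<in> R" "s \<in> R" "r - \<kappa> r = s - \<kappa> s"
    have "(r - \<kappa> r) - r \<in> K" "(r - \<kappa> r) - s \<in> K"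
      using \<kappa>(1) add_subgroup_uminus[OF K(1)] by (simp, simp add: rs(3))
    then show "r = s"
      using rs(1,2) inM[OF rs(1)] R unfolding transversal_def by blast
  qed
  show ?thesis
    by (rule inj_on_finite[OF inj sub finite_bounded_dual_lattice[OF M(3)]])
qed

text \<open>A character trivial on \<open>K\<close> depends only on the coset. If
  \<open>f m \<noteq> 1\<close>, translation by \<open>m\<close> permutes the cosets and multiplies
  the sum by \<open>f m\<close>, so the sum is 0.\<close>

lemma sum_character_transversal:
  fixes f :: "'a::ab_group_add \<Rightarrow> complex"
  assumes M: "add_subgroup M" and K: "add_subgroup K" "K \<subseteq> M"
    and R: "transversal M K R" "finite R"
    and f: "\<And>x y. x \<in> M \<Longrightarrow> y \<in> M \<Longrightarrow> f (x + y) = f x * f y" "\<And>x. x \<in> K \<Longrightarrow> f x = 1"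
  shows "(\<Sum>r\<in>R. f r) = (if \<forall>x\<in>M. f x = 1 then of_nat (card R) else 0)"
proof (cases "\<forall>x\<in>M. f x = 1")
  case True
  then have "(\<Sum>r\<in>R. f r) = (\<Sum>r\<in>R. 1)"
    using R(1) by (intro sum.cong) (auto simp: transversal_def)
  then show ?thesis using True by simp
next
  case False
  then obtain m where m: "m \<in> M" "f m \<noteq> 1" by blast
  have RM: "R \<subseteq> M" using R by (simp add: transversal_def)
  \<comment> \<open>The permutation of the cosets, realised on representatives:
    \<open>\<sigma> r\<close> represents the coset of \<open>r + m\<close>.\<close>
  have "\<exists>s. s \<in> R \<and> r + m - s \<in> K" if "r \<in> R" for r
    using that RM m(1) R(1) add_subgroup_add[OF M] unfolding transversal_def by (meson subsetD)
  then obtain \<sigma> where \<sigma>: "\<And>r. r \<in> R \<Longrightarrow> \<sigma> r \<in> R" "\<And>r. r \<in> R \<Longrightarrow> r + m - \<sigma> r \<in> K" by metis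
  have "inj_on \<sigma> R"
  proof (rule inj_onI)
    fix r s assume rs: "r \<in> R" "s \<in> R" "\<sigma> r = \<sigma> s"
    then have "(r + m - \<sigma> r) - (s + m - \<sigma> s) \<in> K"
      using \<sigma>(2) K(1) rs by (blast intro: add_subgroup_diff)
    then have "r - s \<in> K" using rs(3) by simp
    moreover have "r - r \<in> K" using K(1) by (simp add: add_subgroup_0)
    ultimately show "r = s" using rs RM R(1) unfolding transversal_def by blast
  qed
  then have "bij_betw \<sigma> R R"
    using \<sigma>(1) R(2) by (simp add: bij_betw_def endo_inj_surj image_subset_iff)
  then have "(\<Sum>r\<in>R. f r) = (\<Sum>r\<in>R. f (\<sigma> r))" by (rule sum.reindex_bij_betw[symmetric])
  also have "\<dots> = (\<Sum>r\<in>R. f r * f m)"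
  proof (rule sum.cong[OF refl])
    fix r assume r: "r \<in> R"
    have "f (\<sigma> r) = f (\<sigma> r) * f (r + m - \<sigma> r)" using f(2) \<sigma>(2)[OF r] by simp
    also have "\<dots> = f (\<sigma> r + (r + m - \<sigma> r))"
      using \<sigma>[OF r] K(2) RM by (intro f(1)[symmetric]) auto
    also have "\<dots> = f r * f m" using f(1)[of r m] r RM m(1) by auto
    finally show "f (\<sigma> r) = f r * f m" .
  qed
  also have "\<dots> = (\<Sum>r\<in>R. f r) * f m" by (simp add: sum_distrib_right)
  finally have "(\<Sum>r\<in>R. f r) = 0" using m(2) by (metis mult_cancel_left1)
  then show ?thesis using m by auto
qed

section \<open>Duality of lattices\<close>

text \<open>Characters are represented additively, as real functions that are homomorphisms modulo \<open>\<int>\<close>.\<close>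
definition mod1_hom :: "'a::ab_group_add set \<Rightarrow> ('a \<Rightarrow> real) \<Rightarrow> bool" where
  "mod1_hom K \<phi> \<longleftrightarrow> (\<forall>x\<in>K. \<forall>y\<in>K. \<phi> (x + y) - \<phi> x - \<phi> y \<in> \<int>)"

lemma mod1_hom_add: "mod1_hom K \<phi> \<Longrightarrow> x \<in> K \<Longrightarrow> y \<in> K \<Longrightarrow> \<phi> (x + y) - \<phi> x - \<phi> y \<in> \<int>"
  unfolding mod1_hom_def by blast

lemma mod1_hom_0:
  assumes "mod1_hom K \<phi>" "add_subgroup K"
  shows "\<phi> 0 \<in> \<int>"
  using Ints_minus[OF mod1_hom_add[OF assms(1), of 0 0]] add_subgroup_0[OF assms(2)] by simp

lemma mod1_hom_diff:
  assumes "mod1_hom K \<phi>" "add_subgroup K" "x \<in> K" "y \<in> K"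
  shows "\<phi> (x - y) - (\<phi> x - \<phi> y) \<in> \<int>"
proof -
  have "\<phi> ((x - y) + y) - \<phi> (x - y) - \<phi> y \<in> \<int>"
    using assms by (intro mod1_hom_add) (auto intro: add_subgroup_diff)
  from Ints_minus[OF this] show ?thesis by (simp add: algebra_simps)
qed

lemma mod1_hom_scaleR:
  fixes x :: "'a::real_vector"
  assumes \<phi>: "mod1_hom K \<phi>" and K: "add_subgroup K" and x: "x \<in> K"
  shows "\<phi> (of_int j *\<^sub>R x) - of_int j * \<phi> x \<in> \<int>"
proof (induction j rule: int_induct[where k = 0])
  case base
  then show ?case using mod1_hom_0[OF \<phi> K] by simp
next
  case (step1 j)
  from mod1_hom_add[OF \<phi> add_subgroup_scaleR[OF K x, of j] x] step1(2)
  have "\<phi> (of_int j *\<^sub>R x + x) - \<phi> (of_int j *\<^sub>R x) - \<phi> x + (\<phi> (of_int j *\<^sub>R x) - of_int j * \<phi> x) \<in> \<int>"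
    by (rule Ints_add)
  then show ?case by (simp add: algebra_simps)
next
  case (step2 j)
  from mod1_hom_diff[OF \<phi> K add_subgroup_scaleR[OF K x, of j] x] step2(2)
  have "\<phi> (of_int j *\<^sub>R x - x) - (\<phi> (of_int j *\<^sub>R x) - \<phi> x) + (\<phi> (of_int j *\<^sub>R x) - of_int j * \<phi> x) \<in> \<int>"
    by (rule Ints_add)
  then show ?case by (simp add: algebra_simps)
qed

section \<open>Extension of characters\<close>

lemma int_subgroup_principal:
  assumes J: "add_subgroup (J :: int set)"
  obtains g :: int where "0 \<le> g" "J = range (\<lambda>q. g * q)"
proof (cases "J = {0}")
  case True
  then show ?thesis by (intro that[of 0]) auto
next
  case False
  have mult: "g * q \<in> J" if "g \<in> J" for g q
  proof (induction q rule: int_induct[where k = 0])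
    case (step1 i)
    then show ?case using add_subgroup_add[OF J step1(2) that] by (simp add: algebra_simps)
  next
    case (step2 i)
    then show ?case using add_subgroup_diff[OF J step2(2) that] by (simp add: algebra_simps)
  qed (use add_subgroup_0[OF J] in simp)
  obtain j where j: "j \<in> J" "j \<noteq> 0" using False add_subgroup_0[OF J] by blast
  define P where "P n \<longleftrightarrow> 0 < n \<and> int n \<in> J" for n
  have "P (nat \<bar>j\<bar>)"
    using j add_subgroup_uminus[OF J j(1)] by (auto simp: P_def abs_if)
  then have g: "P (LEAST n. P n)" and least: "\<And>n. P n \<Longrightarrow> (LEAST n. P n) \<le> n"
    by (auto intro: LeastI Least_le)
  define g where "g = int (LEAST n. P n)"
  have g0: "0 < g" "g \<in> J" using g by (auto simp: P_def g_def)
  have "j \<in> range (\<lambda>q. g * q)" if "j \<in> J" for j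
  proof -
    have "j mod g \<in> J"
      using add_subgroup_diff[OF J that mult[OF g0(2), of "j div g"]] by (simp add: minus_mult_div_eq_mod)
    moreover have "0 \<le> j mod g" "j mod g < g" using g0(1) by simp_all
    moreover have "\<not> P (nat (j mod g))"
      using least[of "nat (j mod g)"] \<open>0 \<le> j mod g\<close> \<open>j mod g < g\<close> unfolding g_def by linarith
    ultimately have "j mod g = 0"
      by (auto simp: P_def)
    then show ?thesis by (auto elim: dvdE simp: mod_eq_0_iff_dvd)
  qed
  then have "J = range (\<lambda>q. g * q)" using mult[OF g0(2)] by auto
  then show ?thesis using g0(1) by (intro that[of g]) auto
qed

text \<open>For a subgroup \<open>K\<close>, the subgroup generated by \<open>K\<close> and
  \<open>e\<close>.\<close>

definition adjoin :: "'a::real_vector set \<Rightarrow> 'a \<Rightarrow> 'a set" where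
  "adjoin K e = {k + of_int j *\<^sub>R e | k j. k \<in> K}"

lemma adjoinI: "k \<in> K \<Longrightarrow> k + of_int j *\<^sub>R e \<in> adjoin K e"
  by (auto simp: adjoin_def)

lemma adjoin_superset: "K \<subseteq> adjoin K e"
  using adjoinI[where j = 0 and e = e] by auto

lemma adjoin_mem: "add_subgroup K \<Longrightarrow> e \<in> adjoin K e"
  using adjoinI[OF add_subgroup_0, where j = 1 and e = e] by auto

lemma add_subgroup_adjoin:
  assumes "add_subgroup K"
  shows "add_subgroup (adjoin K e)"
  unfolding add_subgroup_def
proof (intro conjI ballI)
  show "0 \<in> adjoin K e" using adjoin_superset add_subgroup_0[OF assms] by blast
  fix x y assume "x \<in> adjoin K e" "y \<in> adjoin K e"
  then obtain k j l i where "k \<in> K" "l \<in> K" "x = k + of_int j *\<^sub>R e" "y = l + of_int i *\<^sub>R e"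
    by (auto simp: adjoin_def)
  then show "x - y \<in> adjoin K e"
    using adjoinI[OF add_subgroup_diff[OF assms, of k l], of "j - i" e] by (simp add: algebra_simps)
qed

text \<open>The value \<open>t\<close> at \<open>e\<close> is admissible as soon as it agrees modulo
  \<int> with \<open>\<phi>\<close> on those multiples of \<open>e\<close> that already lie in
  \<open>K\<close>. Fixing \<open>t\<close> in advance is what later produces a character with a
  prescribed nontrivial value.\<close>

lemma mod1_hom_extend_with:
  fixes e :: "'a::real_vector"
  assumes K: "add_subgroup K" and \<phi>: "mod1_hom K \<phi>"
    and t: "\<And>j. of_int j *\<^sub>R e \<in> K \<Longrightarrow> \<phi> (of_int j *\<^sub>R e) - of_int j * t \<in> \<int>"
  obtains \<psi> where "mod1_hom (adjoin K e) \<psi>" "\<And>x. x \<in> K \<Longrightarrow> \<psi> x - \<phi> x \<in> \<int>" "\<psi> e - t \<in> \<int>"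
proof -
  \<comment> \<open>An arbitrary choice of a decomposition \<open>k + j e\<close>; another choice
    changes \<open>\<psi>\<close> only by an integer.\<close>
  define rep where "rep x = (SOME p. fst p \<in> K \<and> x = fst p + of_int (snd p) *\<^sub>R e)" for x
  define \<psi> where "\<psi> x = \<phi> (fst (rep x)) + of_int (snd (rep x)) * t" for x
  have \<psi>: "\<psi> (k + of_int j *\<^sub>R e) - (\<phi> k + of_int j * t) \<in> \<int>" if k: "k \<in> K" for k j
  proof -
    let ?x = "k + of_int j *\<^sub>R e"
    obtain l i where li: "rep ?x = (l, i)" by fastforce
    have "fst (rep ?x) \<in> K \<and> ?x = fst (rep ?x) + of_int (snd (rep ?x)) *\<^sub>R e"
      unfolding rep_def by (rule someI[of _ "(k, j)"]) (use k in auto)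
    then have l: "l \<in> K" "l - k = of_int (j - i) *\<^sub>R e"
      unfolding li by (auto simp: algebra_simps)
    have "\<phi> (l - k) - of_int (j - i) * t \<in> \<int>"
      unfolding l(2) using add_subgroup_diff[OF K l(1) k] by (intro t) (simp only: l(2))
    from Ints_diff[OF this mod1_hom_diff[OF \<phi> K l(1) k]]
    show ?thesis by (simp add: \<psi>_def li algebra_simps)
  qed
  show ?thesis
  proof (rule that)
    show "mod1_hom (adjoin K e) \<psi>"
      unfolding mod1_hom_def
    proof (intro ballI)
      fix x y assume "x \<in> adjoin K e" "y \<in> adjoin K e"
      then obtain k j l i where *: "k \<in> K" "l \<in> K" and x: "x = k + of_int j *\<^sub>R e" and y: "y = l + of_int i *\<^sub>R e"
        by (auto simp: adjoin_def)
      have xy: "x + y = (k + l) + of_int (j + i) *\<^sub>R e" by (simp add: x y algebra_simps)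
      have "\<psi> (x + y) - (\<phi> (k + l) + of_int (j + i) * t) \<in> \<int>"
        unfolding xy using * K by (intro \<psi> add_subgroup_add)
      moreover have "\<psi> x - (\<phi> k + of_int j * t) \<in> \<int>" "\<psi> y - (\<phi> l + of_int i * t) \<in> \<int>"
        unfolding x y using * by (auto intro: \<psi>)
      moreover have "\<phi> (k + l) - \<phi> k - \<phi> l \<in> \<int>"
        using * by (intro mod1_hom_add[OF \<phi>])
      ultimately have "\<psi> (x + y) - (\<phi> (k + l) + of_int (j + i) * t) - (\<psi> x - (\<phi> k + of_int j * t))
          - (\<psi> y - (\<phi> l + of_int i * t)) + (\<phi> (k + l) - \<phi> k - \<phi> l) \<in> \<int>"
        by (rule Ints_add[OF Ints_diff[OF Ints_diff]])
      then show "\<psi> (x + y) - \<psi> x - \<psi> y \<in> \<int>" by (simp add: algebra_simps)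
    qed
    show "\<psi> x - \<phi> x \<in> \<int>" if "x \<in> K" for x
      using \<psi>[OF that, of 0] by simp
    have "\<psi> e - (\<phi> 0 + t) + \<phi> 0 \<in> \<int>"
      using \<psi>[OF add_subgroup_0[OF K], of 1] mod1_hom_0[OF \<phi> K] by (intro Ints_add) simp_all
    then show "\<psi> e - t \<in> \<int>" by simp
  qed
qed

lemma add_subgroup_multipliers:
  fixes e :: "'a::real_vector"
  assumes "add_subgroup K"
  shows "add_subgroup {j :: int. of_int j *\<^sub>R e \<in> K}"
  using assms by (auto simp: add_subgroup_def scaleR_diff_left)

text \<open>The circle group is divisible: the multiples of \<open>e\<close> in \<open>K\<close> are
  generated by some \<open>g e\<close>, and a suitable value at \<open>e\<close> is obtained by
  dividing \<open>\<phi> (g e)\<close> by \<open>g\<close>.\<close>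

lemma mod1_hom_extend:
  fixes e :: "'a::real_vector"
  assumes K: "add_subgroup K" and \<phi>: "mod1_hom K \<phi>"
  obtains \<psi> where "mod1_hom (adjoin K e) \<psi>" "\<And>x. x \<in> K \<Longrightarrow> \<psi> x - \<phi> x \<in> \<int>"
proof -
  obtain g :: int where g: "{j :: int. of_int j *\<^sub>R e \<in> K} = range (\<lambda>q. g * q)"
    using int_subgroup_principal[OF add_subgroup_multipliers[OF K]] by metis
  \<comment> \<open>For \<open>g = 0\<close> the division yields 0; only the zero multiplier has to
    be respected then, so this value is admissible too.\<close>
  let ?t = "\<phi> (of_int g *\<^sub>R e) / of_int g"
  have gK: "of_int g *\<^sub>R e \<in> K" using g by (metis mem_Collect_eq mult.right_neutral rangeI)
  have "\<phi> (of_int j *\<^sub>R e) - of_int j * ?t \<in> \<int>" if "of_int j *\<^sub>R e \<in> K" for j :: int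
  proof -
    have "j \<in> {j :: int. of_int j *\<^sub>R e \<in> K}" using that by simp
    then obtain q where j: "j = g * q" unfolding g by (rule rangeE)
    show ?thesis
    proof (cases "g = 0")
      case True
      then show ?thesis using mod1_hom_0[OF \<phi> K] by (simp add: j)
    next
      case False
      then show ?thesis
        using mod1_hom_scaleR[OF \<phi> K gK, of q] by (simp add: j mult.commute)
    qed
  qed
  from mod1_hom_extend_with[OF K \<phi> this] show ?thesis using that by metis
qed

lemma mod1_hom_extend_finite:
  fixes A :: "'a::real_vector set"
  assumes "finite A" "add_subgroup K" "mod1_hom K \<phi>"
  shows "\<exists>K' \<psi>. add_subgroup K' \<and> K \<subseteq> K' \<and> A \<subseteq> K' \<and> mod1_hom K' \<psi> \<and> (\<forall>x\<in>K. \<psi> x - \<phi> x \<in> \<int>)"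
  using assms
proof (induction)
  case empty
  then show ?case by (intro exI[of _ K] exI[of _ \<phi>]) auto
next
  case (insert e A)
  then obtain K' \<psi> where *: "add_subgroup K'" "K \<subseteq> K'" "A \<subseteq> K'" "mod1_hom K' \<psi>" "\<forall>x\<in>K. \<psi> x - \<phi> x \<in> \<int>"
    by blast
  obtain \<theta> where \<theta>: "mod1_hom (adjoin K' e) \<theta>" "\<And>x. x \<in> K' \<Longrightarrow> \<theta> x - \<psi> x \<in> \<int>"
    using mod1_hom_extend[OF *(1,4)] by metis
  have "\<theta> x - \<phi> x \<in> \<int>" if "x \<in> K" for x
  proof -
    have "\<theta> x - \<psi> x + (\<psi> x - \<phi> x) \<in> \<int>" using that \<theta>(2) * by (intro Ints_add) auto
    then show ?thesis by simp
  qed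
  then show ?case
    using * \<theta>(1) adjoin_superset[of K' e] adjoin_mem[OF *(1), of e] add_subgroup_adjoin[OF *(1), of e]
    by (intro exI[of _ "adjoin K' e"] exI[of _ \<theta>]) auto
qed

section \<open>Separating points by vectors of the dual lattice\<close>

lemma mod1_hom_sum:
  assumes "mod1_hom K \<phi>" "add_subgroup K" "finite I" "\<And>i. i \<in> I \<Longrightarrow> f i \<in> K"
  shows "\<phi> (\<Sum>i\<in>I. f i) - (\<Sum>i\<in>I. \<phi> (f i)) \<in> \<int>"
  using assms(3,4)
proof (induction)
  case empty
  then show ?case using mod1_hom_0[OF assms(1,2)] by simp
next
  case (insert i I)
  have "\<phi> (f i + sum f I) - \<phi> (f i) - \<phi> (sum f I) + (\<phi> (sum f I) - (\<Sum>i\<in>I. \<phi> (f i))) \<in> \<int>"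
    using insert assms(1,2) by (intro Ints_add mod1_hom_add) (auto intro: add_subgroup_sum)
  then show ?case using insert by (simp add: algebra_simps)
qed

text \<open>The floors exhibit the coefficients as integers, so that a homomorphism modulo \<int>
  can be evaluated termwise.\<close>

lemma int_points_expansion:
  fixes x :: "real ^ 'd"
  assumes "x \<in> int_points"
  shows "x = (\<Sum>i\<in>UNIV. of_int \<lfloor>x $ i\<rfloor> *\<^sub>R axis i 1)"
proof -
  have "of_int \<lfloor>x $ i\<rfloor> = x $ i" for i
    using assms unfolding int_points_def by (metis (mono_tags) Ints_cases floor_of_int mem_Collect_eq)
  then have "(\<Sum>i\<in>UNIV. of_int \<lfloor>x $ i\<rfloor> *\<^sub>R axis i 1) = (\<Sum>i\<in>UNIV. (x $ i) *\<^sub>R axis i (1::real))"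
    by (simp only:)
  also have "\<dots> = x"
    using basis_expansion[of x] by (simp add: scalar_mult_eq_scaleR)
  finally show ?thesis ..
qed

text \<open>A character of the integer points that is trivial on \<open>L\<close> is given by a vector of the
  dual lattice, so it suffices to extend a character of the subgroup generated by \<open>L\<close> and \<open>n\<close>.\<close>
lemma dual_lattice_separates:
  fixes L :: "(real ^ 'd) set"
  assumes L: "add_subgroup L" "L \<subseteq> int_points" and n: "n \<in> int_points" "n \<notin> L"
  obtains \<eta> where "\<eta> \<in> dual_lattice L" "\<eta> \<bullet> n \<notin> \<int>"
proof -
  obtain g :: int where g: "0 \<le> g" "{j :: int. of_int j *\<^sub>R n \<in> L} = range (\<lambda>q. g * q)"
    using int_subgroup_principal[OF add_subgroup_multipliers[OF L(1)]] by metis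
  have "g \<noteq> 1"
  proof
    assume "g = 1"
    then have "1 \<in> {j :: int. of_int j *\<^sub>R n \<in> L}" using g by auto
    then show False using n by simp
  qed
  \<comment> \<open>The value at \<open>n\<close> must be a non-integer whose multiple by
    \<open>g\<close> is an integer, since the character is to be trivial on \<open>L\<close>. As
    \<open>g \<noteq> 1\<close>, \<open>1 / g\<close> works for positive \<open>g\<close>; for
    \<open>g = 0\<close> any non-integer would do.\<close>
  define t :: real where "t = (if g = 0 then 1 / 2 else 1 / of_int g)"
  have t: "t \<notin> \<int>"
  proof
    assume "t \<in> \<int>"
    moreover have "0 < t" "t < 1" using g(1) \<open>g \<noteq> 1\<close> by (auto simp: t_def)
    ultimately show False by (auto elim!: Ints_cases)
  qed
  have zero: "mod1_hom L (\<lambda>x. 0)" by (simp add: mod1_hom_def)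
  have mult: "0 - of_int j * t \<in> \<int>" if "of_int j *\<^sub>R n \<in> L" for j :: int
  proof -
    have "j \<in> {j :: int. of_int j *\<^sub>R n \<in> L}" using that by simp
    then obtain q where j: "j = g * q" unfolding g(2) by (rule rangeE)
    have "0 - of_int j * t = of_int (if g = 0 then 0 else - q)"
      by (simp add: j t_def)
    then show ?thesis by (simp only: Ints_of_int)
  qed
  obtain \<phi> where \<phi>: "mod1_hom (adjoin L n) \<phi>" "\<And>x. x \<in> L \<Longrightarrow> \<phi> x - 0 \<in> \<int>" "\<phi> n - t \<in> \<int>"
    by (rule mod1_hom_extend_with[OF L(1) zero mult]) (assumption, blast)
  obtain K \<psi> where K: "add_subgroup K" "adjoin L n \<subseteq> K" "range (\<lambda>i. axis i 1) \<subseteq> K" "mod1_hom K \<psi>"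
      and \<psi>: "\<forall>x\<in>adjoin L n. \<psi> x - \<phi> x \<in> \<int>"
    using mod1_hom_extend_finite[OF finite_imageI[OF finite] add_subgroup_adjoin[OF L(1)] \<phi>(1)] by metis
  \<comment> \<open>The coordinates are the values of the extended character at the unit vectors, so
    the inner product with \<open>\<eta>\<close> agrees with \<open>\<psi>\<close> modulo \<int> on
    all integer points.\<close>
  define \<eta> :: "real ^ 'd" where "\<eta> = (\<chi> i. \<psi> (axis i 1))"
  have \<eta>: "\<psi> x - \<eta> \<bullet> x \<in> \<int>" if x: "x \<in> int_points" for x
  proof -
    let ?f = "\<lambda>i. of_int \<lfloor>x $ i\<rfloor> *\<^sub>R axis i 1 :: real ^ 'd"
    have int: "of_int \<lfloor>x $ i\<rfloor> = x $ i" for i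
      using x unfolding int_points_def by (metis (mono_tags) Ints_cases floor_of_int mem_Collect_eq)
    have ax: "axis i 1 \<in> K" for i using K(3) by auto
    have "\<psi> (\<Sum>i\<in>UNIV. ?f i) - (\<Sum>i\<in>UNIV. \<psi> (?f i)) + (\<Sum>i\<in>UNIV. \<psi> (?f i) - of_int \<lfloor>x $ i\<rfloor> * \<psi> (axis i 1)) \<in> \<int>"
      by (intro Ints_add Ints_sum mod1_hom_sum[OF K(4,1)] mod1_hom_scaleR[OF K(4,1)] add_subgroup_scaleR[OF K(1)] ax) auto
    moreover have "(\<Sum>i\<in>UNIV. of_int \<lfloor>x $ i\<rfloor> * \<psi> (axis i 1)) = \<eta> \<bullet> x"
      by (simp add: int \<eta>_def inner_vec_def mult.commute)
    ultimately show ?thesis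
      using int_points_expansion[OF x] by (simp add: sum_subtractf)
  qed
  show ?thesis
  proof (rule that)
    show "\<eta> \<in> dual_lattice L"
      unfolding dual_lattice_def
    proof safe
      fix x assume x: "x \<in> L"
      have "\<phi> x - 0 + (\<psi> x - \<phi> x) - (\<psi> x - \<eta> \<bullet> x) \<in> \<int>"
        by (rule Ints_diff[OF Ints_add[OF \<phi>(2)]]) (use x L(2) \<psi> \<eta> adjoin_superset[of L n] in blast)+
      then show "\<eta> \<bullet> x \<in> \<int>" by simp
    qed
    show "\<eta> \<bullet> n \<notin> \<int>"
    proof
      assume "\<eta> \<bullet> n \<in> \<int>"
      then have "\<eta> \<bullet> n + (\<psi> n - \<eta> \<bullet> n) - (\<psi> n - \<phi> n) - (\<phi> n - t) \<in> \<int>"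
        by (rule Ints_diff[OF Ints_diff[OF Ints_add]])
           (use n(1) \<phi>(3) \<psi> \<eta> adjoin_mem[OF L(1), of n] in blast)+
      then show False using t by simp
    qed
  qed
qed

section \<open>Orthogonality and the index of the integer points in the dual lattice\<close>

lemma cis_2pi_eq_1_iff: "cis (2 * pi * t) = 1 \<longleftrightarrow> t \<in> \<int>"
proof
  assume "cis (2 * pi * t) = 1"
  then have "cos (2 * pi * t) = 1" by (metis cis.sel(1) one_complex.sel(1))
  then obtain k :: int where "2 * pi * t = of_int k * 2 * pi" by (auto simp: cos_one_2pi_int)
  then have "t = of_int k" by simp
  then show "t \<in> \<int>" by simp
qed (rule cis_multiple_2pi)

lemma sum_cis_transversal:
  fixes M K R :: "(real ^ 'd) set"
  assumes "add_subgroup M" "add_subgroup K" "K \<subseteq> M" "transversal M K R" "finite R"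
    and x: "x \<in> dual_lattice K"
  shows "(\<Sum>r\<in>R. cis (2 * pi * (x \<bullet> r))) = (if x \<in> dual_lattice M then of_nat (card R) else 0)"
proof -
  have "(\<Sum>r\<in>R. cis (2 * pi * (x \<bullet> r))) =
      (if \<forall>m\<in>M. cis (2 * pi * (x \<bullet> m)) = 1 then of_nat (card R) else 0)"
    using assms(1-5) by (rule sum_character_transversal)
      (use x in \<open>auto simp: cis_2pi_eq_1_iff dual_lattice_def cis_mult inner_add_right ring_distribs\<close>)
  also have "(\<forall>m\<in>M. cis (2 * pi * (x \<bullet> m)) = 1) \<longleftrightarrow> x \<in> dual_lattice M"
    by (simp add: cis_2pi_eq_1_iff dual_lattice_def)
  finally show ?thesis .
qed

context
  fixes L :: "(real ^ 'd) set"
  assumes L: "full_rank_sublattice L"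
begin

lemma sublattice_props: "add_subgroup L" "L \<subseteq> int_points" "span L = UNIV"
  using L full_rank_sublattice_add_subgroup[OF L] by (auto simp: full_rank_sublattice_def)

lemma int_points_subset_dual: "int_points \<subseteq> dual_lattice L"
  using dual_lattice_antimono[OF sublattice_props(2)] dual_lattice_int_points by blast

text \<open>Membership in \<open>L\<close> implies membership in the bidual by definition; for the
  converse, a point outside \<open>L\<close> is separated from it by some dual vector.\<close>

lemma bidual_lattice: "x \<in> int_points \<Longrightarrow> x \<in> dual_lattice (dual_lattice L) \<longleftrightarrow> x \<in> L"
  using dual_lattice_separates[OF sublattice_props(1,2), of x]
  unfolding dual_lattice_def mem_Collect_eq inner_commute[of x] by blast

lemma finite_transversal_dual:
  "transversal (dual_lattice L) int_points H \<Longrightarrow> finite H"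
  by (rule finite_transversal[OF add_subgroup_dual_lattice subset_refl sublattice_props(3)
        add_subgroup_int_points int_points_subset_dual span_int_points])

text \<open>The integrality of \<open>x\<close> makes its character trivial on the integer points,
  so orthogonality applies; triviality on the whole dual lattice means membership in the
  bidual.\<close>

lemma sum_cis_dual:
  assumes H: "transversal (dual_lattice L) int_points H" and x: "x \<in> int_points"
  shows "(\<Sum>h\<in>H. cis (2 * pi * (h \<bullet> x))) = (if x \<in> L then of_nat (card H) else 0)"
  using sum_cis_transversal[OF add_subgroup_dual_lattice add_subgroup_int_points int_points_subset_dual H
      finite_transversal_dual[OF H], of x] x bidual_lattice[OF x]
  by (simp add: dual_lattice_int_points inner_commute)

text \<open>Double counting: sum \<open>cis (2 * pi * (h \<bullet> r))\<close> over \<open>h\<close>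
  in \<open>H\<close> and over \<open>r\<close> in a transversal \<open>R\<close> of
  \<open>L\<close> in the integer points. Either order of summation leaves only the trivial coset of
  the other group, which gives \<open>card H\<close> one way and \<open>card R\<close> the
  other.\<close>

lemma card_transversal_dual:
  assumes H: "transversal (dual_lattice L) int_points H"
  shows "card H = lattice_det L"
proof -
  obtain R where R: "transversal int_points L R"
    using transversal_exists[OF sublattice_props(1)] by metis
  have finR: "finite R"
    by (rule finite_transversal[OF add_subgroup_int_points _ span_int_points sublattice_props R])
       (simp add: dual_lattice_int_points)
  have finH: "finite H" by (rule finite_transversal_dual[OF H])
  have HL: "H \<subseteq> dual_lattice L" and RZ: "R \<subseteq> int_points"
    using H R by (auto simp: transversal_def)
  have "\<exists>!r. r \<in> R \<and> 0 - r \<in> L"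
    using R add_subgroup_0[OF add_subgroup_int_points] unfolding transversal_def by blast
  then have "\<exists>!r. r \<in> R \<and> r \<in> L"
    using add_subgroup_uminus[OF sublattice_props(1)] by (metis diff_0 minus_minus)
  then obtain r0 where "R \<inter> L = {r0}" by blast
  have "\<exists>!h. h \<in> H \<and> 0 - h \<in> int_points"
    using H add_subgroup_0[OF add_subgroup_dual_lattice] unfolding transversal_def by blast
  then have "\<exists>!h. h \<in> H \<and> h \<in> int_points"
    using add_subgroup_uminus[OF add_subgroup_int_points] by (metis diff_0 minus_minus)
  then obtain h0 where "H \<inter> int_points = {h0}" by blast
  have "of_nat (card H) = (\<Sum>r\<in>R. if r \<in> L then of_nat (card H) else (0::complex))"
    using finR \<open>R \<inter> L = {r0}\<close> by (simp add: sum.If_cases Int_def[symmetric])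
  also have "\<dots> = (\<Sum>r\<in>R. \<Sum>h\<in>H. cis (2 * pi * (h \<bullet> r)))"
    by (intro sum.cong refl sum_cis_dual[OF H, symmetric]) (use RZ in auto)
  also have "\<dots> = (\<Sum>h\<in>H. \<Sum>r\<in>R. cis (2 * pi * (h \<bullet> r)))"
    by (rule sum.swap)
  also have "\<dots> = (\<Sum>h\<in>H. if h \<in> int_points then of_nat (card R) else 0)"
    using sum_cis_transversal[OF add_subgroup_int_points sublattice_props(1,2) R finR] HL
    by (intro sum.cong refl) (auto simp: dual_lattice_int_points)
  also have "\<dots> = of_nat (card R)"
    using finH \<open>H \<inter> int_points = {h0}\<close> by (simp add: sum.If_cases Int_def[symmetric])
  finally have "card H = card R" by (simp only: of_nat_eq_iff)
  then show ?thesis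
    using card_transversal[OF sublattice_props(1) R] by (simp add: lattice_det_def)
qed

end

section \<open>The Fourier transform of the thickening\<close>

text \<open>Fubini: \<open>lborel\<close> on vectors is the image of the product measure indexed by
  the basis vectors, and \<open>axis_index\<close> translates that indexing into
  coordinates.\<close>

lemma integral_lborel_prod_vec:
  fixes f :: "'d::finite \<Rightarrow> real \<Rightarrow> complex"
  assumes f: "\<And>i. integrable lborel (f i)"
  shows "(LINT x|lborel. (\<Prod>i\<in>UNIV. f i (x $ i))) = (\<Prod>i\<in>UNIV. LINT t|lborel. f i t)"
    and "integrable lborel (\<lambda>x::real^'d. \<Prod>i\<in>UNIV. f i (x $ i))"
proof -
  interpret product_sigma_finite "\<lambda>_::real^'d. lborel :: real measure" by standard
  define g where "g b = f (axis_index b)" for b :: "real^'d"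
  have Basis: "(Basis :: (real^'d) set) = (\<lambda>i. axis i 1) ` UNIV"
    by (auto simp: Basis_vec_def)
  have inj: "inj (\<lambda>i. axis i 1 :: real^'d)"
    by (auto simp: inj_on_def axis_eq_axis)
  have prod: "(\<Prod>b\<in>Basis. h b) = (\<Prod>i\<in>UNIV. h (axis i 1))" for h :: "real^'d \<Rightarrow> complex"
    unfolding Basis by (rule prod.reindex_cong[OF inj refl refl])
  have integrand: "(\<Prod>i\<in>UNIV. f i ((\<Sum>b\<in>Basis. y b *\<^sub>R b) $ i)) = (\<Prod>b\<in>Basis. g b (y b))"
    for y :: "real^'d \<Rightarrow> real"
  proof -
    have "(\<Sum>b\<in>Basis. y b *\<^sub>R b) $ i = y (axis i 1)" for i
    proof -
      have "(\<Sum>b\<in>Basis. y b *\<^sub>R b) $ i = (\<Sum>b\<in>Basis. y b *\<^sub>R b) \<bullet> axis i 1"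
        by (simp only: inner_axis inner_real_def mult_1_right)
      also have "\<dots> = y (axis i 1)"
        by (rule inner_sum_left_Basis) (auto simp: Basis_vec_def)
      finally show ?thesis .
    qed
    then show ?thesis by (simp add: prod g_def axis_index_axis)
  qed
  have meas: "(\<lambda>x::real^'d. \<Prod>i\<in>UNIV. f i (x $ i)) \<in> borel_measurable borel"
  proof (rule borel_measurable_prod)
    fix i
    have "f i \<in> borel_measurable borel" using borel_measurable_integrable[OF f[of i]] by simp
    moreover have "(\<lambda>x::real^'d. x $ i) \<in> borel_measurable borel"
      by (intro borel_measurable_continuous_onI continuous_intros)
    ultimately show "(\<lambda>x::real^'d. f i (x $ i)) \<in> borel_measurable borel"
      by (rule measurable_compose[rotated])
  qed
  have meas_sum: "(\<lambda>y. \<Sum>b\<in>Basis. y b *\<^sub>R b) \<in> (\<Pi>\<^sub>M b\<in>(Basis :: (real^'d) set). lborel :: real measure) \<rightarrow>\<^sub>M borel"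
    by measurable
  have int: "integrable lborel (g b)" for b
    unfolding g_def by (rule f)
  show "(LINT x|lborel. (\<Prod>i\<in>UNIV. f i (x $ i))) = (\<Prod>i\<in>UNIV. LINT t|lborel. f i t)"
    unfolding lborel_eq[where 'a = "real^'d"]
    by (subst integral_distr[OF meas_sum meas], unfold integrand, subst product_integral_prod)
       (use int in \<open>auto simp: prod g_def axis_index_axis\<close>)
  show "integrable lborel (\<lambda>x::real^'d. \<Prod>i\<in>UNIV. f i (x $ i))"
    unfolding lborel_eq[where 'a = "real^'d"]
    by (subst integrable_distr_eq[OF meas_sum meas], unfold integrand, rule product_integrable_prod)
       (use int in auto)
qed

text \<open>The fundamental theorem of calculus, separately at \<open>s = 0\<close>, where the
  integrand is constant on the interval. The difference of the two endpoint exponentials produces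
  the sine, and the midpoint \<open>a\<close> produces the phase.\<close>

lemma integral_interval_cis:
  fixes a s \<epsilon> :: real
  assumes "0 < \<epsilon>"
  shows "(LINT t|lborel. indicator {a - \<epsilon> / 2..a + \<epsilon> / 2} t * cis (- 2 * pi * (t * s))) =
           cis (- 2 * pi * (a * s)) * of_real (\<epsilon> * norm_sinc (\<epsilon> * s))"
    and "integrable lborel (\<lambda>t. indicator {a - \<epsilon> / 2..a + \<epsilon> / 2} t * cis (- 2 * pi * (t * s)))"
proof -
  let ?I = "{a - \<epsilon> / 2..a + \<epsilon> / 2}"
  let ?e = "\<lambda>t. cis (- 2 * pi * (t * s))"
  have ind: "indicator ?I t * ?e t = indicator ?I t *\<^sub>R ?e t" for t
    by (simp add: indicator_def)
  have cont: "continuous_on ?I ?e"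
    unfolding cis_conv_exp by (intro continuous_intros)
  show "integrable lborel (\<lambda>t. indicator ?I t * ?e t)"
    using borel_integrable_atLeastAtMost'[OF cont] unfolding set_integrable_def ind .
  show "(LINT t|lborel. indicator ?I t * ?e t) = ?e a * of_real (\<epsilon> * norm_sinc (\<epsilon> * s))"
  proof (cases "s = 0")
    case True
    have "(LINT t|lborel. indicator ?I t * ?e t) = of_real (a + \<epsilon> / 2) - of_real (a - \<epsilon> / 2)"
      unfolding ind using assms True cont
      by (intro integral_FTC_atLeastAtMost) (auto intro!: derivative_eq_intros)
    also have "\<dots> = ?e a * of_real (\<epsilon> * norm_sinc (\<epsilon> * s))"
      using True by simp
    finally show ?thesis .
  next
    case False
    define c where "c = - 2 * pi * s"
    have c: "c \<noteq> 0" using False by (simp add: c_def)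
    have e: "?e t = cis (c * t)" for t by (simp add: c_def mult_ac)
    have "(LINT t|lborel. indicator ?I t *\<^sub>R ?e t) =
        - \<i> / of_real c * cis (c * (a + \<epsilon> / 2)) - (- \<i> / of_real c * cis (c * (a - \<epsilon> / 2)))"
    proof (rule integral_FTC_atLeastAtMost)
      fix x
      show "((\<lambda>t. - \<i> / of_real c * cis (c * t)) has_vector_derivative ?e x) (at x within ?I)"
        unfolding e unfolding cis_conv_exp of_real_mult using c
        by (intro has_vector_derivative_real_field)
           (auto intro!: derivative_eq_intros)
    qed (use assms cont in auto)
    also have "\<dots> = - \<i> / of_real c * (cis (c * a) * (cis (c * \<epsilon> / 2) - cis (- (c * \<epsilon> / 2))))"
      by (simp add: cis_mult algebra_simps add_divide_distrib diff_divide_distrib)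
    also have "cis (c * \<epsilon> / 2) - cis (- (c * \<epsilon> / 2)) = 2 * \<i> * of_real (sin (c * \<epsilon> / 2))"
      by (simp add: complex_eq_iff)
    also have "- \<i> / of_real c * (cis (c * a) * (2 * \<i> * of_real (sin (c * \<epsilon> / 2)))) =
        cis (c * a) * of_real (2 * sin (c * \<epsilon> / 2) / c)"
      by (simp add: mult_ac)
    also have "2 * sin (c * \<epsilon> / 2) / c = \<epsilon> * norm_sinc (\<epsilon> * s)"
      using False assms by (simp add: c_def norm_sinc_def mult_ac)
    finally show ?thesis unfolding ind unfolding e .
  qed
qed

section \<open>Transforms of a cube and of the thickening\<close>

lemma exp_conv_cis: "exp (2 * complex_of_real pi * \<i> * complex_of_real t) = cis (2 * pi * t)"
    "exp (- 2 * complex_of_real pi * \<i> * complex_of_real t) = cis (- 2 * pi * t)"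
  by (simp_all add: cis_conv_exp mult_ac)

lemma prod_cis: "finite A \<Longrightarrow> (\<Prod>i\<in>A. cis (f i)) = cis (\<Sum>i\<in>A. f i)"
  by (induction A rule: finite_induct) (simp_all add: cis_mult)

definition cube :: "real \<Rightarrow> real ^ 'd \<Rightarrow> (real ^ 'd) set" where
  "cube \<epsilon> n = (+) n ` cbox (vec (- \<epsilon> / 2)) (vec (\<epsilon> / 2))"

lemma mem_cube: "x \<in> cube \<epsilon> n \<longleftrightarrow> (\<forall>i. x $ i \<in> {n $ i - \<epsilon> / 2..n $ i + \<epsilon> / 2})"
proof -
  have "x \<in> cube \<epsilon> n \<longleftrightarrow> x - n \<in> cbox (vec (- \<epsilon> / 2)) (vec (\<epsilon> / 2))"
    unfolding cube_def by (auto intro: rev_image_eqI[of "x - n"])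
  also have "\<dots> \<longleftrightarrow> (\<forall>i. x $ i \<in> {n $ i - \<epsilon> / 2..n $ i + \<epsilon> / 2})"
  proof -
    have "vec (- \<epsilon> / 2) $ i \<le> (x - n) $ i \<and> (x - n) $ i \<le> vec (\<epsilon> / 2) $ i \<longleftrightarrow>
        x $ i \<in> {n $ i - \<epsilon> / 2..n $ i + \<epsilon> / 2}" for i
      by auto
    then show ?thesis by (simp only: mem_box_cart)
  qed
  finally show ?thesis .
qed

text \<open>Both the indicator of the cube and the exponential factor over the coordinates.\<close>

lemma integral_cube_cis:
  fixes n \<xi> :: "real ^ 'd"
  assumes "0 < \<epsilon>"
  shows "(LINT x|lborel. indicator (cube \<epsilon> n) x * cis (- 2 * pi * (x \<bullet> \<xi>))) =
           cis (- 2 * pi * (n \<bullet> \<xi>)) * of_real (\<epsilon> ^ CARD('d) * (\<Prod>k\<in>UNIV. norm_sinc (\<epsilon> * \<xi> $ k)))"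
    and "integrable lborel (\<lambda>x. indicator (cube \<epsilon> n) x * cis (- 2 * pi * (x \<bullet> \<xi>)))"
proof -
  let ?f = "\<lambda>i t. indicator {n $ i - \<epsilon> / 2..n $ i + \<epsilon> / 2} t * cis (- 2 * pi * (t * \<xi> $ i))"
  have cis: "(\<Prod>i\<in>UNIV. cis (- 2 * pi * (x $ i * \<xi> $ i))) = cis (- 2 * pi * (x \<bullet> \<xi>))" for x :: "real ^ 'd"
    by (simp add: prod_cis inner_vec_def sum_distrib_left)
  have ind: "indicator (cube \<epsilon> n) x = (\<Prod>i\<in>UNIV. indicator {n $ i - \<epsilon> / 2..n $ i + \<epsilon> / 2} (x $ i) :: complex)"
    for x :: "real ^ 'd"
    using mem_cube[of x \<epsilon> n] by (auto simp: indicator_def prod_eq_1_iff intro!: prod.neutral[symmetric])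
  have eq: "indicator (cube \<epsilon> n) x * cis (- 2 * pi * (x \<bullet> \<xi>)) = (\<Prod>i\<in>UNIV. ?f i (x $ i))" for x
    unfolding ind cis[symmetric] prod.distrib ..
  show "integrable lborel (\<lambda>x. indicator (cube \<epsilon> n) x * cis (- 2 * pi * (x \<bullet> \<xi>)))"
    unfolding eq by (intro integral_lborel_prod_vec integral_interval_cis assms)
  have "(LINT x|lborel. indicator (cube \<epsilon> n) x * cis (- 2 * pi * (x \<bullet> \<xi>))) = (\<Prod>i\<in>UNIV. LINT t|lborel. ?f i t)"
    unfolding eq by (intro integral_lborel_prod_vec integral_interval_cis assms)
  also have "\<dots> = cis (- 2 * pi * (n \<bullet> \<xi>)) * of_real (\<epsilon> ^ CARD('d) * (\<Prod>k\<in>UNIV. norm_sinc (\<epsilon> * \<xi> $ k)))"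
    unfolding integral_interval_cis(1)[OF assms] prod.distrib cis by (simp add: prod.distrib)
  finally show "(LINT x|lborel. indicator (cube \<epsilon> n) x * cis (- 2 * pi * (x \<bullet> \<xi>))) =
      cis (- 2 * pi * (n \<bullet> \<xi>)) * of_real (\<epsilon> ^ CARD('d) * (\<Prod>k\<in>UNIV. norm_sinc (\<epsilon> * \<xi> $ k)))" .
qed

text \<open>Cubes of side at most 1 around distinct integer points can meet only in their
  boundaries, which form a null set; off it, each point lies in at most one cube.\<close>

lemma cubes_almost_disjoint:
  fixes F :: "(real ^ 'd) set"
  assumes F: "finite F" "F \<subseteq> int_points" and \<epsilon>: "\<epsilon> \<le> 1"
  shows "AE x in lebesgue. indicator (thickening \<epsilon> F) x = (\<Sum>n\<in>F. indicator (cube \<epsilon> n) x :: complex)"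
proof -
  \<comment> \<open>The hyperplanes through the faces of the unit cubes. For smaller \<epsilon> the
    cubes are disjoint, so one null set serves every \<epsilon> \<le> 1.\<close>
  let ?N = "\<Union>n\<in>F. \<Union>k. {x :: real ^ 'd. x $ k = n $ k + 1 / 2} \<union> {x. x $ k = n $ k - 1 / 2}"
  have hyperplane: "negligible {x :: real ^ 'd. x $ k = c}" for k c
    using negligible_standard_hyperplane[of "axis k 1 :: real ^ 'd" c]
    by (simp add: inner_axis axis_in_Basis_iff)
  have "negligible ?N"
    using F(1) by (auto intro!: negligible_Union negligible_Un hyperplane)
  then have "AE x in lebesgue. x \<notin> ?N"
    by (intro AE_not_in) (simp only: negligible_iff_null_sets)
  then show ?thesis
  proof (rule AE_mp, intro AE_I2 impI)
    fix x assume x: "x \<notin> ?N"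
    have uniq: "n = m" if "n \<in> F" "m \<in> F" "x \<in> cube \<epsilon> n" "x \<in> cube \<epsilon> m" for n m
    proof (rule ccontr)
      assume "n \<noteq> m"
      then obtain k where k: "n $ k \<noteq> m $ k" by (auto simp: vec_eq_iff)
      have "n \<in> int_points" "m \<in> int_points" using that F(2) by auto
      then have "n $ k - m $ k \<in> \<int>" by (simp add: int_points_def)
      then have "1 \<le> \<bar>n $ k - m $ k\<bar>" using k by (intro Ints_nonzero_abs_ge1) auto
      moreover have "\<bar>x $ k - n $ k\<bar> \<le> 1 / 2" "\<bar>x $ k - m $ k\<bar> \<le> 1 / 2"
        using that(3,4) \<epsilon> unfolding mem_cube atLeastAtMost_iff by (smt (verit) field_sum_of_halves)+
      \<comment> \<open>Two centres at distance at least 1, each within 1/2 of \<open>x $ k\<close>,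
        force equality in both bounds.\<close>
      ultimately have "x $ k = n $ k + 1 / 2 \<or> x $ k = n $ k - 1 / 2" by linarith
      then show False using x that(1) by auto
    qed
    have thick: "thickening \<epsilon> F = (\<Union>n\<in>F. cube \<epsilon> n)" by (simp add: thickening_def cube_def)
    show "indicator (thickening \<epsilon> F) x = (\<Sum>n\<in>F. indicator (cube \<epsilon> n) x :: complex)"
    proof (cases "\<exists>m\<in>F. x \<in> cube \<epsilon> m")
      case True
      then obtain m where m: "m \<in> F" "x \<in> cube \<epsilon> m" by blast
      have "(\<Sum>n\<in>F. indicator (cube \<epsilon> n) x) = (\<Sum>n\<in>F. if n = m then 1 else 0 :: complex)"
        using uniq m by (intro sum.cong) (auto simp: indicator_def)
      moreover have "x \<in> thickening \<epsilon> F" using m by (auto simp: thick)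
      ultimately show ?thesis using m F(1) by simp
    next
      case False
      then show ?thesis by (auto simp: thick indicator_def)
    qed
  qed
qed

text \<open>Almost everywhere the indicator is a sum over cubes, and all cubes contribute the same
  real factor, differing only in phase. Borel measurability of the integrands allows the passage
  from \<open>lebesgue\<close> to \<open>lborel\<close>.\<close>

lemma fourier_thickening:
  fixes F :: "(real ^ 'd) set"
  assumes F: "finite F" "F \<subseteq> int_points" and \<epsilon>: "0 < \<epsilon>" "\<epsilon> \<le> 1"
  shows "fourier (indicator (thickening \<epsilon> F)) \<xi> =
    of_real (\<epsilon> ^ CARD('d) * (\<Prod>k\<in>UNIV. norm_sinc (\<epsilon> * \<xi> $ k))) * (\<Sum>n\<in>F. cis (- 2 * pi * (n \<bullet> \<xi>)))"
proof -
  let ?e = "\<lambda>x. cis (- 2 * pi * (x \<bullet> \<xi>))"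
  have closed: "closed (cube \<epsilon> n)" for n :: "real ^ 'd"
    unfolding cube_def by (intro closed_translation closed_cbox)
  have "closed (thickening \<epsilon> F)"
    unfolding thickening_def cube_def[symmetric] by (intro closed_UN F ballI closed)
  have e: "?e \<in> borel_measurable borel"
    unfolding cis_conv_exp by (intro borel_measurable_continuous_onI continuous_intros)
  have sets: "cube \<epsilon> n \<in> sets borel" "thickening \<epsilon> F \<in> sets borel" for n :: "real ^ 'd"
    using closed \<open>closed (thickening \<epsilon> F)\<close> by (auto intro: borel_closed)
  note [measurable] = e sets
  have ind_meas: "(\<lambda>x. indicator (thickening \<epsilon> F) x * ?e x) \<in> borel_measurable lborel"
    and sum_meas: "(\<lambda>x. \<Sum>n\<in>F. indicator (cube \<epsilon> n) x * ?e x) \<in> borel_measurable lborel"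
    unfolding measurable_lborel1 by measurable
  have "fourier (indicator (thickening \<epsilon> F)) \<xi> = (LINT x|lebesgue. indicator (thickening \<epsilon> F) x * ?e x)"
    unfolding fourier_def exp_conv_cis ..
  also have "\<dots> = (LINT x|lebesgue. (\<Sum>n\<in>F. indicator (cube \<epsilon> n) x * ?e x))"
  proof (rule integral_cong_AE)
    show "AE x in lebesgue. indicator (thickening \<epsilon> F) x * ?e x = (\<Sum>n\<in>F. indicator (cube \<epsilon> n) x * ?e x)"
      using cubes_almost_disjoint[OF F \<epsilon>(2)] by eventually_elim (simp only: sum_distrib_right)
  qed (rule measurable_completion[OF ind_meas] measurable_completion[OF sum_meas])+
  also have "\<dots> = (LINT x|lborel. (\<Sum>n\<in>F. indicator (cube \<epsilon> n) x * ?e x))"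
    by (rule integral_completion[OF sum_meas])
  also have "\<dots> = (\<Sum>n\<in>F. LINT x|lborel. indicator (cube \<epsilon> n) x * ?e x)"
    by (intro Bochner_Integration.integral_sum integral_cube_cis \<epsilon>)
  also have "\<dots> = of_real (\<epsilon> ^ CARD('d) * (\<Prod>k\<in>UNIV. norm_sinc (\<epsilon> * \<xi> $ k))) * (\<Sum>n\<in>F. ?e n)"
    unfolding integral_cube_cis(1)[OF \<epsilon>(1)] by (simp only: sum_distrib_right[symmetric] mult.commute)
  finally show ?thesis .
qed

section \<open>Summation over the dual lattice\<close>

text \<open>Integer points correspond to functions into the integers, so the sum is a product of
  one-dimensional sums, each equal to \<open>1 / \<epsilon>\<close> whatever the shift.\<close>

lemma has_sum_prod_norm_sinc_square:
  fixes \<eta> :: "real ^ 'd"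
  assumes "0 < \<epsilon>" "\<epsilon> \<le> 1"
  shows "((\<lambda>m. \<Prod>k\<in>UNIV. (norm_sinc (\<epsilon> * (\<eta> + m) $ k))\<^sup>2) has_sum 1 / \<epsilon> ^ CARD('d)) int_points"
proof -
  let ?v = "\<lambda>g::'d \<Rightarrow> int. (\<chi> i. real_of_int (g i))"
  have "((\<lambda>g. \<Prod>k\<in>UNIV. (norm_sinc (\<epsilon> * (\<eta> $ k + of_int (g k))))\<^sup>2) has_sum (\<Prod>k\<in>(UNIV :: 'd set). 1 / \<epsilon>))
      (PiE UNIV (\<lambda>_. UNIV :: int set))"
    using assms by (intro has_sum_prod_PiE_nonneg has_sum_norm_sinc_square_scaled) auto
  moreover have "bij_betw ?v (PiE UNIV (\<lambda>_. UNIV)) int_points"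
  proof (rule bij_betwI[where g = "\<lambda>x k. \<lfloor>x $ k\<rfloor>"])
    show "?v (\<lambda>k. \<lfloor>x $ k\<rfloor>) = x" if "x \<in> int_points" for x :: "real ^ 'd"
      using that by (auto simp: int_points_def vec_eq_iff elim!: allE Ints_cases)
  qed (auto simp: int_points_def)
  moreover have "(\<eta> + ?v g) $ k = \<eta> $ k + of_int (g k)" for g k
    by simp
  ultimately show ?thesis
    using has_sum_reindex_bij_betw[where g = ?v and A = "PiE UNIV (\<lambda>_. UNIV)" and B = int_points and
        f = "\<lambda>m. \<Prod>k\<in>UNIV. (norm_sinc (\<epsilon> * (\<eta> + m) $ k))\<^sup>2"]
    by (simp only: prod_constant power_one_over)
qed

text \<open>Pairs are grouped by their difference \<open>n\<close>; those with difference
  \<open>n\<close> correspond, through the first component, to the points of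
  \<open>F \<inter> translate F n\<close>.\<close>

lemma sum_card_inter_translate:
  fixes F L :: "(real ^ 'd) set"
  assumes "finite F"
  shows "(\<Sum>n\<in>difference_set F \<inter> L. card (F \<inter> translate F n)) = card {p \<in> F \<times> F. fst p - snd p \<in> L}"
proof -
  let ?P = "{p \<in> F \<times> F. fst p - snd p \<in> L}"
  have "difference_set F = (\<lambda>(a, b). a - b) ` (F \<times> F)"
    by (auto simp: difference_set_def)
  then have fin: "finite (difference_set F)" using assms by simp
  have "card (F \<inter> translate F n) = (\<Sum>p | p \<in> ?P \<and> fst p - snd p = n. 1)"
    if n: "n \<in> difference_set F \<inter> L" for n
  proof -
    have "bij_betw fst {p. p \<in> ?P \<and> fst p - snd p = n} (F \<inter> translate F n)"
      by (rule bij_betwI[where g = "\<lambda>a. (a, a - n)"]) (use n in \<open>auto simp: translate_def\<close>)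
    then show ?thesis using bij_betw_same_card by fastforce
  qed
  then have "(\<Sum>n\<in>difference_set F \<inter> L. card (F \<inter> translate F n)) =
      (\<Sum>n\<in>difference_set F \<inter> L. \<Sum>p | p \<in> ?P \<and> fst p - snd p = n. 1)"
    by (rule sum.cong[OF refl])
  also have "\<dots> = (\<Sum>p\<in>?P. 1)"
    using assms fin by (intro sum.group) (auto simp: difference_set_def, blast)
  finally show ?thesis by simp
qed

text \<open>Expanding the square gives a sum over pairs from \<open>F\<close>; after exchanging the
  sums, orthogonality keeps exactly the pairs whose difference lies in \<open>L\<close>.\<close>

lemma sum_cmod_square_dual:
  fixes F L :: "(real ^ 'd) set"
  assumes F: "finite F" "F \<subseteq> int_points" and L: "full_rank_sublattice L"
    and H: "transversal (dual_lattice L) int_points H"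
  shows "(\<Sum>h\<in>H. (cmod (\<Sum>n\<in>F. cis (2 * pi * (h \<bullet> n))))\<^sup>2) =
    real (lattice_det L) * real (card {p \<in> F \<times> F. fst p - snd p \<in> L})"
proof -
  have "complex_of_real (\<Sum>h\<in>H. (cmod (\<Sum>n\<in>F. cis (2 * pi * (h \<bullet> n))))\<^sup>2) =
      (\<Sum>h\<in>H. \<Sum>p\<in>F \<times> F. cis (2 * pi * (h \<bullet> (fst p - snd p))))"
    unfolding of_real_sum cmod_sum_square sum.cartesian_product
    by (intro sum.cong refl) (auto simp: cis_cnj cis_mult inner_diff_right algebra_simps)
  also have "\<dots> = (\<Sum>p\<in>F \<times> F. \<Sum>h\<in>H. cis (2 * pi * (h \<bullet> (fst p - snd p))))"
    by (rule sum.swap)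
  also have "\<dots> = (\<Sum>p\<in>F \<times> F. if fst p - snd p \<in> L then of_nat (card H) else 0)"
    using F(2) by (intro sum.cong refl sum_cis_dual[OF L H] add_subgroup_diff[OF add_subgroup_int_points]) auto
  also have "\<dots> = of_real (real (card H) * real (card {p \<in> F \<times> F. fst p - snd p \<in> L}))"
    using F(1) by (simp add: sum.If_cases Int_def mult.commute)
  finally show ?thesis
    by (simp only: of_real_eq_iff card_transversal_dual[OF L H])
qed

theorem has_sum_dual_lattice:
  fixes F L :: "(real ^ 'd) set"
  assumes F: "finite F" "F \<subseteq> int_points" and L: "full_rank_sublattice L" and \<epsilon>: "0 < \<epsilon>" "\<epsilon> \<le> 1"
  shows "((\<lambda>\<xi>. (\<Prod>k\<in>UNIV. (norm_sinc (\<epsilon> * \<xi> $ k))\<^sup>2) * (cmod (\<Sum>n\<in>F. cis (2 * pi * (\<xi> \<bullet> n))))\<^sup>2)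
    has_sum real (lattice_det L) * real (card {p \<in> F \<times> F. fst p - snd p \<in> L}) / \<epsilon> ^ CARD('d)) (dual_lattice L)"
proof -
  obtain H where H: "transversal (dual_lattice L) int_points H"
    using transversal_exists[OF add_subgroup_int_points] by blast
  let ?E = "\<lambda>\<xi>. (cmod (\<Sum>n\<in>F. cis (2 * pi * (\<xi> \<bullet> n))))\<^sup>2"
  let ?S = "\<lambda>\<xi>::real^'d. (\<Prod>k\<in>UNIV. (norm_sinc (\<epsilon> * \<xi> $ k))\<^sup>2)"
  \<comment> \<open>Since \<open>F\<close> consists of integer points, an integer shift of the
    frequency leaves every exponential unchanged. On each coset only the sinc factors vary.\<close>
  have E: "?E (h + m) = ?E h" if "m \<in> int_points" for h m
  proof -
    have "cis (2 * pi * ((h + m) \<bullet> n)) = cis (2 * pi * (h \<bullet> n))" if "n \<in> F" for n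
    proof -
      have "cis (2 * pi * (m \<bullet> n)) = 1"
        using \<open>m \<in> int_points\<close> \<open>n \<in> F\<close> F(2) by (auto simp: cis_2pi_eq_1_iff intro!: inner_int_points)
      then show ?thesis
        by (simp add: inner_add_left ring_distribs flip: cis_mult)
    qed
    then show ?thesis by simp
  qed
  have "((\<lambda>(h, m). ?S (h + m) * ?E (h + m)) has_sum
      real (lattice_det L) * real (card {p \<in> F \<times> F. fst p - snd p \<in> L}) / \<epsilon> ^ CARD('d)) (H \<times> int_points)"
  proof (rule has_sum_Sigma_nonneg)
    fix h
    have "((\<lambda>m. ?S (h + m) * ?E h) has_sum 1 / \<epsilon> ^ CARD('d) * ?E h) int_points"
      using has_sum_prod_norm_sinc_square[OF \<epsilon>] by (rule has_sum_cmult_left)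
    then show "((\<lambda>m. case (h, m) of (h, m) \<Rightarrow> ?S (h + m) * ?E (h + m)) has_sum 1 / \<epsilon> ^ CARD('d) * ?E h) int_points"
      by (rule iffD1[OF has_sum_cong, rotated]) (simp only: prod.case E)
  next
    have "(\<Sum>h\<in>H. 1 / \<epsilon> ^ CARD('d) * ?E h) =
        real (lattice_det L) * real (card {p \<in> F \<times> F. fst p - snd p \<in> L}) / \<epsilon> ^ CARD('d)"
      unfolding sum_distrib_left[symmetric] sum_cmod_square_dual[OF F L H] by simp
    then show "((\<lambda>h. 1 / \<epsilon> ^ CARD('d) * ?E h) has_sum
        real (lattice_det L) * real (card {p \<in> F \<times> F. fst p - snd p \<in> L}) / \<epsilon> ^ CARD('d)) H"
      by (intro has_sum_finiteI finite_transversal_dual[OF L H]) simp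
  qed (auto intro!: mult_nonneg_nonneg prod_nonneg)
  moreover have "bij_betw (\<lambda>(h, m). h + m) (H \<times> int_points) (dual_lattice L)"
    by (rule bij_betw_transversal[OF add_subgroup_dual_lattice add_subgroup_int_points int_points_subset_dual[OF L] H])
  ultimately show ?thesis
    using has_sum_reindex_bij_betw[where g = "\<lambda>(h, m). h + m" and A = "H \<times> int_points" and
        B = "dual_lattice L" and f = "\<lambda>\<xi>. ?S \<xi> * ?E \<xi>"]
    by (simp only: case_prod_unfold)
qed

lemma has_sum_remove:
  fixes f :: "'a \<Rightarrow> real"
  assumes "(f has_sum S) A" "a \<in> A"
  shows "(f has_sum S - f a) (A - {a})"
proof -
  have "f summable_on (A - {a})"
    using has_sum_imp_summable[OF assms(1)] by (rule summable_on_subset) auto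
  then have T: "(f has_sum infsum f (A - {a})) (A - {a})" by simp
  then have "(f has_sum f a + infsum f (A - {a})) (insert a (A - {a}))"
    by (intro has_sum_insert) auto
  moreover have "insert a (A - {a}) = A" using assms(2) by auto
  ultimately show ?thesis
    using has_sum_unique[OF assms(1)] T by fastforce
qed

theorem theorem3:
  fixes F L :: "(real ^ 'd) set" and \<epsilon> :: real
  assumes "finite F" and "F \<subseteq> int_points"
    and "full_rank_sublattice L"
    and "0 < \<epsilon>" and "\<epsilon> \<le> 1"
  shows
    "((\<lambda>\<xi>. (cmod (fourier (indicator (thickening \<epsilon> F)) \<xi>))\<^sup>2) summable_on (dual_lattice L - {0}) \<and>
     real (\<Sum>n\<in>difference_set F \<inter> L. card (F \<inter> translate F n)) =
       1 / real (lattice_det L) * (real (card F))\<^sup>2 * \<epsilon> ^ CARD('d) +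
       1 / (\<epsilon> ^ CARD('d) * real (lattice_det L)) *
         (\<Sum>\<^sub>\<infinity>\<xi>\<in>dual_lattice L - {0}. (cmod (fourier (indicator (thickening \<epsilon> F)) \<xi>))\<^sup>2)) \<and>
    ((\<lambda>\<xi>. (\<Prod>k\<in>UNIV. (norm_sinc (\<epsilon> * \<xi> $ k))\<^sup>2) *
           (cmod (\<Sum>n\<in>F. exp (2 * complex_of_real pi * \<i> * complex_of_real (\<xi> \<bullet> n))))\<^sup>2)
       summable_on (dual_lattice L - {0}) \<and>
     real (\<Sum>n\<in>difference_set F \<inter> L. card (F \<inter> translate F n)) =
       1 / real (lattice_det L) * (real (card F))\<^sup>2 * \<epsilon> ^ CARD('d) +
       \<epsilon> ^ CARD('d) / real (lattice_det L) *
         (\<Sum>\<^sub>\<infinity>\<xi>\<in>dual_lattice L - {0}.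
            (\<Prod>k\<in>UNIV. (norm_sinc (\<epsilon> * \<xi> $ k))\<^sup>2) *
            (cmod (\<Sum>n\<in>F. exp (2 * complex_of_real pi * \<i> * complex_of_real (\<xi> \<bullet> n))))\<^sup>2))"
proof -
  define S where "S \<xi> = (\<Prod>k\<in>UNIV. (norm_sinc (\<epsilon> * \<xi> $ k))\<^sup>2) * (cmod (\<Sum>n\<in>F. cis (2 * pi * (\<xi> \<bullet> n))))\<^sup>2"
    for \<xi> :: "real ^ 'd"
  define N where "N = real (card {p \<in> F \<times> F. fst p - snd p \<in> L})"
  define D where "D = real (lattice_det L)"
  define E where "E = \<epsilon> ^ CARD('d)"
  have E: "E > 0" using assms by (simp add: E_def)
  \<comment> \<open>The transversal serves to show that the index \<open>D\<close> is positive, as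
    needed for dividing by it: \<open>H\<close> is finite and nonempty, and has \<open>D\<close>
    elements.\<close>
  obtain H where H: "transversal (dual_lattice L) int_points H"
    using transversal_exists[OF add_subgroup_int_points] by blast
  have "H \<noteq> {}"
    using H add_subgroup_0[OF add_subgroup_dual_lattice, of L] by (auto simp: transversal_def)
  then have D: "D > 0"
    using card_transversal_dual[OF assms(3) H] finite_transversal_dual[OF assms(3) H] by (auto simp: D_def card_gt_0_iff)
  \<comment> \<open>The two exponential sums are complex conjugates, so the summands of (a) and (b)
    differ only by the constant \<open>E\<^sup>2\<close>, and one sum settles both.\<close>
  have four: "(cmod (fourier (indicator (thickening \<epsilon> F)) \<xi>))\<^sup>2 = E\<^sup>2 * S \<xi>" for \<xi>
  proof -
    have "(\<Sum>n\<in>F. cis (- 2 * pi * (n \<bullet> \<xi>))) = cnj (\<Sum>n\<in>F. cis (2 * pi * (\<xi> \<bullet> n)))"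
      by (simp add: cis_cnj inner_commute)
    then show ?thesis
      unfolding fourier_thickening[OF assms(1,2,4,5)] S_def
      by (simp only: norm_mult norm_of_real power_mult_distrib power2_abs complex_mod_cnj
                     prod_power_distrib E_def mult.assoc)
  qed
  have S0: "S 0 = (real (card F))\<^sup>2" by (simp add: S_def)
  \<comment> \<open>The frequency 0 contributes \<open>(real (card F))\<^sup>2\<close>; splitting it
    off yields the main term of both identities.\<close>
  have hs: "(S has_sum D * N / E - (real (card F))\<^sup>2) (dual_lattice L - {0})"
    using has_sum_remove[OF has_sum_dual_lattice[OF assms] add_subgroup_0[OF add_subgroup_dual_lattice]]
    unfolding S_def[symmetric] S0 D_def N_def E_def .
  have hs': "((\<lambda>\<xi>. E\<^sup>2 * S \<xi>) has_sum E\<^sup>2 * (D * N / E - (real (card F))\<^sup>2)) (dual_lattice L - {0})"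
    using hs by (rule has_sum_cmult_right)
  have N: "real (\<Sum>n\<in>difference_set F \<inter> L. card (F \<inter> translate F n)) = N"
    unfolding N_def sum_card_inter_translate[OF assms(1)] ..
  show ?thesis
    unfolding four exp_conv_cis S_def[symmetric] N D_def[symmetric] E_def[symmetric]
      infsumI[OF hs] infsumI[OF hs']
    using has_sum_imp_summable[OF hs] has_sum_imp_summable[OF hs'] D E
    by (simp add: field_simps power2_eq_square)
qed

end
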